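(* Let $U,n_t$ be positive integers. For every code $C_{U,n_t}\in\mathfrak{C}_{U,n_t}$ there exists a constant $c>0$ such that $$ D(N_1,N_2,\dots,N_U)\ \ge\ \frac{c}{(N_1N_2\cdots N_U)^{(U-1)n_t}} $$ for all positive integers $N_1,\dots,N_U$. In particular, writing $D(N)=D(N,N,\dots,N)$, $$ D(N)\ \ge\ \frac{c}{N^{U(U-1)n_t}} $$ for all positive integers $N$.
   Context: All fields are subfields of $\mathbb{C}$, and $\mathcal{O}_E$ denotes the ring of integers of a number field $E$. Suitable data: $K$ is an imaginary quadratic extension of $\mathbb{Q}$ with class number $1$; $L/K$ is a cyclic Galois extension of degree $Un_t$ such that $L=K(\alpha)$ for some $\alpha\in\mathbb{R}$; $\sigma$ is a generator of $\mathrm{Gal}(L/K)$; $p\in\mathcal{O}_K$ is a prime that is inert in $L/K$ (i.e. $p\mathcal{O}_K$ is a nonzero prime ideal and $p\mathcal{O}_L$ is again prime). Put $\tau=\sigma^U$. For $x_1,\dots,x_{n_t}\in\mathcal{O}_L$ let $M(x_1,\dots,x_{n_t})$ be the $n_t\times n_t$ matrix whose $(i,j)$ entry is $\tau^{j-1}(x_{i-j+1})$ if $i\ge j$ and $p\,\tau^{j-1}(x_{i-j+1+n_t})$ if $i<j$. Automorphisms are applied to matrices entrywise. Let $k$ be an integer with $k>\frac{U(n_t-1)}{2}$. For $j=1,\dots,U$, the code $\mathcal{C}_j$ of the $j$th user is the set of $n_t\times Un_t$ matrices $$B_j=\left(M_j,\ \sigma(M_j),\ \dots,\ p^{-k}\sigma^{j-1}(M_j),\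 \dots,\ \sigma^{U-1}(M_j)\right)$$ (the $l$th block is $\sigma^{l-1}(M_j)$, with the extra factor $p^{-k}$ exactly when $l=j$), where $M_j=M(x_{j,1},\dots,x_{j,n_t})$, $x_{j,h}\in\mathcal{O}_L$, and $x_{j,h}\ne0$ for some $h$. The code $C_{U,n_t}(L/K,p,\sigma,k)$ is the set of all $Un_t\times Un_t$ matrices obtained by stacking $B_1,\dots,B_U$ vertically with $B_j\in\mathcal{C}_j$. $\mathfrak{C}_{U,n_t}$ is the family of all codes $C_{U,n_t}(L/K,p,\sigma,k)$ obtained from any suitable $(K,L,p,\sigma)$ and any integer $k>\frac{U(n_t-1)}{2}$. Each $\mathbf{L}_j=\mathcal{C}_j\cup\{0\}$ is a lattice of rank $r=2Un_t^2$ in $M_{n_t\times Un_t}(\mathbb{C})$. Fix a $\mathbb{Z}$-basis $B_{j,1},\dots,B_{j,r}$ of each $\mathbf{L}_j$ (as part of the code; constants may depend on it), and for a positive integer $N_j$ let $\mathbf{L}_j(N_j)=\{\sum_{i=1}^r b_iB_{j,i}: b_i\in\mathbb{Z},\ -N_j\le b_i\le N_j\}$. The decay function of the code is $$D(N_1,\dots,N_U)=\min_{X_j\in\mathbf{L}_j(N_j)\setminus\{0\},\ j=1,\dots,U}\left|\det\left(X_1^T,X_2^T,\dots,X_U^T\right)^T\right|.$$ *)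

theory Defs
  imports
    "HOL-Algebra.Embedded_Algebras"
    "HOL-Algebra.Generated_Fields"
    "HOL-Algebra.QuotRing"
    "HOL-Algebra.Bij"
    "HOL-Algebra.Algebraic_Closure_Type"
    "Jordan_Normal_Form.Determinant"
begin

section \<open>Subfields of the complex numbers\<close>

abbreviation CC :: "complex ring" where
  "CC \<equiv> ring_of_type_algebra"

definition int_ring_of :: "complex set \<Rightarrow> complex ring" where
  "int_ring_of E = CC\<lparr>carrier := {x \<in> E. algebraic_int x}\<rparr>"

definition nonzero_ideals :: "complex set \<Rightarrow> complex set set" where
  "nonzero_ideals E = {I. ideal I (int_ring_of E) \<and> I \<noteq> {0}}"

text \<open>Two nonzero ideals \<open>I\<close>, \<open>J\<close> are in the same class iff \<open>aI = bJ\<close> for some nonzero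
  integers \<open>a\<close>, \<open>b\<close> of the field.\<close>

definition ideal_class_rel :: "complex set \<Rightarrow> (complex set \<times> complex set) set" where
  "ideal_class_rel E = {(I, J). I \<in> nonzero_ideals E \<and> J \<in> nonzero_ideals E \<and>
     (\<exists>a \<in> carrier (int_ring_of E) - {0}. \<exists>b \<in> carrier (int_ring_of E) - {0}.
        (\<lambda>x. a * x) ` I = (\<lambda>x. b * x) ` J)}"

definition class_number :: "complex set \<Rightarrow> nat" where
  "class_number E = card (nonzero_ideals E // ideal_class_rel E)"

definition imaginary_quadratic :: "complex set \<Rightarrow> bool" where
  "imaginary_quadratic K \<longleftrightarrow> subfield K CC \<and> ring.dimension CC 2 \<rat> K \<and> \<not> K \<subseteq> \<real>"

text \<open>Automorphisms of \<open>L\<close> are represented by functions that are \<open>undefined\<close> outside \<open>L\<close>,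
  so that distinct functions are distinct automorphisms.\<close>

definition gal_group :: "complex set \<Rightarrow> complex set \<Rightarrow> (complex \<Rightarrow> complex) monoid" where
  "gal_group K L = (BijGroup L)\<lparr>carrier :=
     {f \<in> Bij L. f \<in> ring_iso (CC\<lparr>carrier := L\<rparr>) (CC\<lparr>carrier := L\<rparr>) \<and> (\<forall>x\<in>K. f x = x)}\<rparr>"

definition galois_extension :: "complex set \<Rightarrow> complex set \<Rightarrow> bool" where
  "galois_extension K L \<longleftrightarrow> subfield K CC \<and> subfield L CC \<and> K \<subseteq> L \<and>
     ring.finite_dimension CC K L \<and>
     {x \<in> L. \<forall>f \<in> carrier (gal_group K L). f x = x} = K"

definition inert :: "complex \<Rightarrow> complex set \<Rightarrow> complex set \<Rightarrow> bool" where
  "inert p K L \<longleftrightarrow> p \<in> carrier (int_ring_of K) \<and> p \<noteq> 0 \<and>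
     primeideal (PIdl\<^bsub>int_ring_of K\<^esub> p) (int_ring_of K) \<and>
     primeideal (PIdl\<^bsub>int_ring_of L\<^esub> p) (int_ring_of L)"

definition suitable ::
  "nat \<Rightarrow> nat \<Rightarrow> complex set \<Rightarrow> complex set \<Rightarrow> complex \<Rightarrow> (complex \<Rightarrow> complex) \<Rightarrow> bool" where
  "suitable U n K L p \<sigma> \<longleftrightarrow>
     imaginary_quadratic K \<and> class_number K = 1 \<and>
     galois_extension K L \<and> ring.dimension CC (U * n) K L \<and>
     (\<exists>\<alpha>\<in>\<real>. L = generate_field CC (insert \<alpha> K)) \<and>
     \<sigma> \<in> carrier (gal_group K L) \<and>
     subgroup_generated (gal_group K L) {\<sigma>} = gal_group K L \<and>
     inert p K L"

section \<open>The codes\<close>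

text \<open>Users \<open>j\<close>, coefficients \<open>x h\<close> and basis elements \<open>B i\<close> are numbered from 1, whereas
  matrix rows and columns are numbered from 0; \<open>n\<close> is the number of transmit antennas.\<close>

definition code_matrix ::
  "nat \<Rightarrow> complex \<Rightarrow> (complex \<Rightarrow> complex) \<Rightarrow> (nat \<Rightarrow> complex) \<Rightarrow> complex mat" where
  "code_matrix n p \<tau> x = mat n n (\<lambda>(i, j).
     if j \<le> i then (\<tau> ^^ j) (x (i - j + 1)) else p * (\<tau> ^^ j) (x (i + n + 1 - j)))"

definition user_matrix ::
  "nat \<Rightarrow> nat \<Rightarrow> complex \<Rightarrow> (complex \<Rightarrow> complex) \<Rightarrow> int \<Rightarrow> nat \<Rightarrow> complex mat \<Rightarrow> complex mat" where
  "user_matrix U n p \<sigma> k j M = mat n (U * n) (\<lambda>(a, b).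
     let l = b div n + 1 in
       (if l = j then p powi (- k) else 1) * map_mat (\<sigma> ^^ (l - 1)) M $$ (a, b mod n))"

definition user_code ::
  "nat \<Rightarrow> nat \<Rightarrow> complex set \<Rightarrow> complex \<Rightarrow> (complex \<Rightarrow> complex) \<Rightarrow> int \<Rightarrow> nat \<Rightarrow> complex mat set" where
  "user_code U n L p \<sigma> k j = {user_matrix U n p \<sigma> k j (code_matrix n p (\<sigma> ^^ U) x) | x.
     (\<forall>h\<in>{1..n}. x h \<in> carrier (int_ring_of L)) \<and> (\<exists>h\<in>{1..n}. x h \<noteq> 0)}"

definition user_lattice ::
  "nat \<Rightarrow> nat \<Rightarrow> complex set \<Rightarrow> complex \<Rightarrow> (complex \<Rightarrow> complex) \<Rightarrow> int \<Rightarrow> nat \<Rightarrow> complex mat set" where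
  "user_lattice U n L p \<sigma> k j = user_code U n L p \<sigma> k j \<union> {0\<^sub>m n (U * n)}"

definition stack :: "nat \<Rightarrow> nat \<Rightarrow> (nat \<Rightarrow> complex mat) \<Rightarrow> complex mat" where
  "stack U n Y = mat (U * n) (U * n) (\<lambda>(a, b). Y (a div n + 1) $$ (a mod n, b))"

section \<open>Lattice bases and the decay function\<close>

definition int_comb ::
  "nat \<Rightarrow> nat \<Rightarrow> nat \<Rightarrow> (nat \<Rightarrow> complex mat) \<Rightarrow> (nat \<Rightarrow> int) \<Rightarrow> complex mat" where
  "int_comb nr nc r B b = mat nr nc (\<lambda>(s, t). \<Sum>i=1..r. of_int (b i) * B i $$ (s, t))"

definition is_Z_basis ::
  "nat \<Rightarrow> nat \<Rightarrow> nat \<Rightarrow> (nat \<Rightarrow> complex mat) \<Rightarrow> complex mat set \<Rightarrow> bool" where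
  "is_Z_basis nr nc r B \<Lambda> \<longleftrightarrow>
     (\<forall>i\<in>{1..r}. B i \<in> \<Lambda>) \<and>
     \<Lambda> = {int_comb nr nc r B b | b. True} \<and>
     (\<forall>b. int_comb nr nc r B b = 0\<^sub>m nr nc \<longrightarrow> (\<forall>i\<in>{1..r}. b i = 0))"

definition lattice_box ::
  "nat \<Rightarrow> nat \<Rightarrow> nat \<Rightarrow> (nat \<Rightarrow> complex mat) \<Rightarrow> nat \<Rightarrow> complex mat set" where
  "lattice_box nr nc r B N =
     {int_comb nr nc r B b | b. \<forall>i\<in>{1..r}. - int N \<le> b i \<and> b i \<le> int N}"

text \<open>\<open>B j i\<close> is the \<open>i\<close>-th basis element of the lattice of user \<open>j\<close>, which has rank
  \<open>2Un\<^sup>2\<close>.\<close>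

definition decay ::
  "nat \<Rightarrow> nat \<Rightarrow> (nat \<Rightarrow> nat \<Rightarrow> complex mat) \<Rightarrow> (nat \<Rightarrow> nat) \<Rightarrow> real" where
  "decay U n B N = Min {norm (det (stack U n Y)) | Y. \<forall>j\<in>{1..U}.
     Y j \<in> lattice_box n (U * n) (2 * U * n\<^sup>2) (B j) (N j) - {0\<^sub>m n (U * n)}}"

end

theory Submission
  imports Defs
begin

text \<open>Expand \<open>det Z\<close> of a code word by Leibniz' formula and compare \<open>p\<close>-adic valuations. For the
  \<open>j\<close>-th user pick the coefficient \<open>x\<^sub>h\<close> minimising \<open>n v\<^sub>p(x\<^sub>h) + h\<close>, which is unique since
  these numbers are distinct modulo \<open>n\<close>. Together with the factors \<open>p\<^sup>-\<^sup>k\<close> on the diagonal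
  blocks this singles out one permutation whose term has strictly smallest valuation, so
  \<open>det Z \<noteq> 0\<close> as soon as \<open>k \<ge> 1\<close>. The blocks are representations of a cyclic algebra, so
  applying \<open>\<sigma>\<^sup>U\<close> to \<open>Z\<close> is a conjugation and \<open>det Z\<close> is fixed by \<open>\<sigma>\<^sup>U\<close>. Hence, up to a fixed
  power of \<open>p\<close>, the product of the \<open>U\<close> conjugates \<open>\<sigma>\<^sup>e(det Z)\<close> is a nonzero integer of the
  imaginary quadratic field \<open>K\<close> and has absolute value at least \<open>1\<close>, whereas each of the \<open>U - 1\<close>
  conjugates other than \<open>det Z\<close> is \<open>O((N\<^sub>1 \<cdots> N\<^sub>U)\<^sup>n)\<close>.\<close>

section \<open>Subfields of the complex numbers\<close>

lemma CC_simps [simp]: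
  "carrier CC = UNIV" "x \<otimes>\<^bsub>CC\<^esub> y = x * y" "\<one>\<^bsub>CC\<^esub> = 1" "\<zero>\<^bsub>CC\<^esub> = 0" "x \<oplus>\<^bsub>CC\<^esub> y = x + y"
  by (auto simp: ring_of_type_algebra_def)

lemma field_CC: "field CC"
  by (rule field_from_type_algebra)

lemma CC_a_inv [simp]: "\<ominus>\<^bsub>CC\<^esub> x = - x"
proof -
  interpret field CC by (rule field_CC)
  show ?thesis by (rule sum_zero_eq_neg[symmetric]) auto
qed

lemma CC_m_inv [simp]: "x \<noteq> 0 \<Longrightarrow> inv\<^bsub>CC\<^esub> x = inverse x"
proof -
  interpret field CC by (rule field_CC)
  assume "x \<noteq> 0"
  then show ?thesis by (intro comm_inv_char) auto
qed

lemma CC_pow [simp]: "x [^]\<^bsub>CC\<^esub> (n::nat) = x ^ n"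
proof -
  interpret field CC by (rule field_CC)
  show ?thesis by (induction n) auto
qed

lemma subfield_CC_D:
  assumes "subfield E CC"
  shows "0 \<in> E" "1 \<in> E" "\<And>x. x \<in> E \<Longrightarrow> - x \<in> E" "\<And>x y. x \<in> E \<Longrightarrow> y \<in> E \<Longrightarrow> x + y \<in> E"
    "\<And>x y. x \<in> E \<Longrightarrow> y \<in> E \<Longrightarrow> x * y \<in> E" "\<And>x. x \<in> E \<Longrightarrow> inverse x \<in> E"
proof -
  interpret field CC by (rule field_CC)
  have r: "subring E CC" using subfieldE(1)[OF assms] .
  show z: "0 \<in> E" "1 \<in> E" "\<And>x. x \<in> E \<Longrightarrow> - x \<in> E" "\<And>x y. x \<in> E \<Longrightarrow> y \<in> E \<Longrightarrow> x + y \<in> E"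
    "\<And>x y. x \<in> E \<Longrightarrow> y \<in> E \<Longrightarrow> x * y \<in> E"
    using subringE(2,3,5,6,7)[OF r] by simp_all
  fix x assume "x \<in> E"
  then show "inverse x \<in> E"
    using subfield_m_inv(1)[OF assms, of x] z by (cases "x = 0") auto
qed

text \<open>\<open>ring.eval\<close> reads a coefficient list from the leading term down,
  \<open>Poly\<close> from the constant term up, hence the \<open>rev\<close>. This bridge makes
  root counting for the type \<open>poly\<close> available for minimal polynomials over
  \<open>CC\<close>.\<close>

lemma eval_CC: "ring.eval CC ks x = poly (Poly (rev ks)) x"
proof -
  interpret field CC by (rule field_CC)
  show ?thesis
    by (induction ks) (auto simp: Poly_append poly_monom Poly_snoc)
qed

lemma generate_field_CC_subset:
  assumes "subfield E CC" "A \<subseteq> E"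
  shows "generate_field CC A \<subseteq> E"
proof -
  interpret field CC by (rule field_CC)
  show ?thesis using generate_field_min_subfield1 assms by auto
qed

text \<open>The simple extension of \<open>K\<close> by \<alpha> is a subfield, so it coincides with
  the generated field \<open>L\<close>. Its dimension is the degree of \<open>Irr\<close>, and a
  list of coefficients is one longer than the degree.\<close>

lemma length_Irr_generate:
  assumes K: "subfield K CC" and L: "subfield L CC" "K \<subseteq> L" "ring.dimension CC m K L"
    and gen: "L = generate_field CC (insert \<alpha> K)"
  shows "length (ring.Irr CC K \<alpha>) = Suc m" and "\<not> ring.transcendental CC K \<alpha>"
proof -
  interpret field CC by (rule field_CC)
  have fd: "finite_dimension K L" using L(3) finite_dimensionI by auto
  have "\<alpha> \<in> L" using gen generate_field.incl[of \<alpha> "insert \<alpha> K" CC] by auto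
  then have alg: "(algebraic over K) \<alpha>"
    using finite_dimension_imp_algebraic[OF K subfieldE(1)[OF L(1)] fd] by auto
  then show "algebraic K \<alpha>" by (simp add: over_def)
  have sub: "subfield (simple_extension K \<alpha>) CC"
    using simple_extension_is_subfield[OF K, of \<alpha>] alg by simp
  have "simple_extension K \<alpha> \<subseteq> L"
    using simple_extension_subring_incl[OF subfieldE(1)[OF L(1)] L(2) \<open>\<alpha> \<in> L\<close>] .
  moreover have "L \<subseteq> simple_extension K \<alpha>"
    unfolding gen using simple_extension_incl[of K \<alpha>] simple_extension_mem[OF subfieldE(1)[OF K], of \<alpha>]
    by (intro generate_field_CC_subset[OF sub]) auto
  ultimately have "dimension (length (Irr K \<alpha>) - 1) K L"
    using dimension_simple_extension[OF K _ alg] by simp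
  then have "length (Irr K \<alpha>) - 1 = m" using dimension_is_inj[OF K _ L(3)] by simp
  moreover have "Irr K \<alpha> \<noteq> []"
    using IrrE(2)[OF K _ alg] unfolding ring_irreducible_def univ_poly_zero by auto
  ultimately show "length (Irr K \<alpha>) = Suc m" by (cases "Irr K \<alpha>") auto
qed

lemma set_coeffs_subset:
  assumes "\<And>i. coeff Q i \<in> E"
  shows "set (coeffs Q) \<subseteq> E"
  using assms by (auto simp: coeffs_def)

text \<open>\<open>P\<close> is the minimal polynomial of \<alpha>, transported to the type
  \<open>poly\<close>; its leading coefficient makes it nonzero.\<close>

lemma generator_annihilator:
  assumes K: "subfield K CC" and L: "subfield L CC" "K \<subseteq> L" "ring.dimension CC m K L"
    and gen: "L = generate_field CC (insert \<alpha> K)"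
  obtains P :: "complex poly" where "P \<noteq> 0" "Polynomial.degree P \<le> m" "poly P \<alpha> = 0" "\<And>i. coeff P i \<in> K"
proof -
  interpret field CC by (rule field_CC)
  note len = length_Irr_generate[OF assms]
  have alg: "(algebraic over K) \<alpha>" using len(2) by (simp add: over_def)
  note I = IrrE[OF K _ alg, simplified]
  define P where "P = Poly (rev (Irr K \<alpha>))"
  have pol: "polynomial\<^bsub>CC\<^esub> K (Irr K \<alpha>)" using I(1) by (simp add: univ_poly_carrier)
  have ne: "Irr K \<alpha> \<noteq> []" using len(1) by auto
  show ?thesis
  proof (rule that)
    have cf: "poly.coeff P i = nth_default 0 (rev (Irr K \<alpha>)) i" for i by (simp add: P_def)
    have "poly.coeff P m = hd (Irr K \<alpha>)"
      unfolding cf using len(1) ne by (simp add: nth_default_def rev_nth hd_conv_nth)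
    then show "P \<noteq> 0" using I(3) by auto
    show "Polynomial.degree P \<le> m"
      using len(1) by (intro degree_le) (auto simp: cf nth_default_def)
    show "poly P \<alpha> = 0" using I(4) by (simp add: P_def eval_CC)
    fix i
    have "set (Irr K \<alpha>) \<subseteq> K" using polynomial_incl[OF pol] .
    then show "poly.coeff P i \<in> K"
      using subfield_CC_D(1)[OF K] nth_mem[of i "rev (Irr K \<alpha>)"]
      unfolding cf nth_default_def by auto
  qed
qed

text \<open>The minimal polynomial of \<alpha> divides every polynomial over \<open>K\<close> that
  vanishes at \<alpha>.\<close>

lemma degree_annihilator_ge:
  assumes K: "subfield K CC" and L: "subfield L CC" "K \<subseteq> L" "ring.dimension CC m K L"
    and gen: "L = generate_field CC (insert \<alpha> K)"
    and Q: "Q \<noteq> 0" "poly Q \<alpha> = 0" "\<And>i. coeff Q i \<in> K"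
  shows "m \<le> Polynomial.degree Q"
proof -
  interpret field CC by (rule field_CC)
  note len = length_Irr_generate[OF assms(1-5)]
  have alg: "(algebraic over K) \<alpha>" using len(2) by (simp add: over_def)
  define q where "q = rev (coeffs Q)"
  have q: "q \<in> carrier (univ_poly CC K)" "q \<noteq> []"
    using Q(1) set_coeffs_subset[OF Q(3)] last_coeffs_eq_coeff_degree[OF Q(1)]
    unfolding univ_poly_def polynomial_def q_def by (auto simp: hd_rev)
  have "eval q \<alpha> = 0" using Q(2) by (simp add: eval_CC q_def)
  then have "Irr K \<alpha> pdivides\<^bsub>CC\<^esub> q"
    using Irr_minimal[OF K _ alg q(1)] by simp
  then have "length (Irr K \<alpha>) - 1 \<le> length q - 1"
    using pdivides_imp_degree_le[OF subfieldE(1)[OF K] IrrE(1)[OF K _ alg] q] by simp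
  then show ?thesis using len(1) Q(1) by (simp add: q_def length_coeffs_degree)
qed

section \<open>Conjugation and rational norms in imaginary quadratic fields\<close>

lemma imaginary_quadratic_basis:
  assumes "imaginary_quadratic K"
  obtains z where "z \<in> K" "z \<notin> \<real>" "\<And>x. x \<in> K \<Longrightarrow> \<exists>a\<in>\<rat>. \<exists>b\<in>\<rat>. x = a * z + b"
proof -
  interpret field CC by (rule field_CC)
  from assms have K: "subfield K CC" "dimension 2 \<rat> K" "\<not> K \<subseteq> \<real>"
    by (auto simp: imaginary_quadratic_def)
  have QQ: "subfield \<rat> CC"
    by (intro subfieldI' subringI) auto
  obtain z where z: "z \<in> K" "z \<notin> \<real>" using K(3) by auto
  \<comment> \<open>A nonreal element is not rational, so it is independent of 1; in dimension 2
    such a pair spans.\<close>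
  have ind: "independent \<rat> [z, 1]"
  proof (intro independent.li_Cons)
    show "z \<notin> Span \<rat> [1]"
    proof
      assume "z \<in> Span \<rat> [1]"
      then have "z \<in> \<rat>" by (auto simp: line_extension_mem_iff)
      then show False using z(2) by (auto elim: Rats_cases')
    qed
  qed auto
  have "Span \<rat> [z, 1] = K"
    using independent_length_eq_dimension[OF QQ K(2) ind] z(1) subfield_CC_D(2)[OF K(1)] by auto
  show ?thesis
  proof (rule that[OF z])
    fix x assume "x \<in> K"
    then have "x \<in> Span \<rat> [z, 1]" using \<open>Span \<rat> [z, 1] = K\<close> by simp
    then show "\<exists>a\<in>\<rat>. \<exists>b\<in>\<rat>. x = a * z + b"
      by (auto simp: line_extension_mem_iff) (metis add.commute)
  qed
qed

text \<open>A nonreal basis element \<open>z\<close> and its conjugate are distinct roots of one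
  rational quadratic polynomial. Hence \<open>z + cnj z\<close> and \<open>z * cnj z\<close> are
  rational, and both claims follow by expanding \<open>x = a * z + b\<close>.\<close>

lemma imaginary_quadratic_cnj:
  assumes "imaginary_quadratic K" "x \<in> K"
  shows "cnj x \<in> K" "x * cnj x \<in> \<rat>"
proof -
  obtain z where z: "z \<in> K" "z \<notin> \<real>" and span: "\<And>x. x \<in> K \<Longrightarrow> \<exists>a\<in>\<rat>. \<exists>b\<in>\<rat>. x = a * z + b"
    using imaginary_quadratic_basis[OF assms(1)] by blast
  have K: "subfield K CC" using assms(1) by (simp add: imaginary_quadratic_def)
  note Kc = subfield_CC_D[OF K]
  obtain u v where uv: "u \<in> \<rat>" "v \<in> \<rat>" "z * z = u * z + v"
    using span[OF Kc(5)[OF z(1) z(1)]] by auto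
  have cr: "cnj q = q" if "q \<in> \<rat>" for q using that by (auto elim!: Rats_cases')
  have "cnj z * cnj z = u * cnj z + v"
    using arg_cong[OF uv(3), of cnj] cr[OF uv(1)] cr[OF uv(2)] by simp
  then have "(z - cnj z) * (z + cnj z - u) = 0"
    using uv(3) by (simp add: algebra_simps)
  then have "z - cnj z = 0 \<or> z + cnj z - u = 0" by (simp only: mult_eq_0_iff)
  moreover have "z \<noteq> cnj z" using z(2) Reals_cnj_iff[of z] by auto
  ultimately have "z + cnj z - u = 0" by simp
  then have tr: "cnj z = u - z" by (simp add: algebra_simps)
  have nm: "z * cnj z = - v" using uv(3) by (simp add: tr algebra_simps)
  obtain a b where ab: "a \<in> \<rat>" "b \<in> \<rat>" "x = a * z + b" using span[OF assms(2)] by auto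
  have "cnj x = a * u + b + b + - x" using ab cr by (simp add: tr algebra_simps)
  moreover have QK: "q \<in> K" if q: "q \<in> \<rat>" for q
  proof -
    have nat: "of_nat n \<in> K" for n by (induction n) (auto intro: Kc)
    have int: "of_int n \<in> K" for n using nat Kc(3) by (cases n rule: int_cases2) auto
    obtain i j where "q = of_int i / of_int j" using q by (auto elim: Rats_cases')
    then show ?thesis using int Kc(5,6) by (simp add: divide_inverse)
  qed
  ultimately show "cnj x \<in> K" using Kc assms(2) ab uv by metis
  have "x * cnj x = a * a * (z * cnj z) + a * b * (z + cnj z) + b * b"
    using ab cr by (simp add: algebra_simps)
  also have "\<dots> = a * a * (- v) + a * b * u + b * b" by (simp only: nm) (simp add: tr)
  finally show "x * cnj x \<in> \<rat>" using ab uv by auto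
qed

section \<open>Galois groups and endomorphisms of subfields\<close>

lemma Bij_ring_iso_CC_iff:
  assumes "f \<in> Bij E"
  shows "f \<in> ring_iso (CC\<lparr>carrier := E\<rparr>) (CC\<lparr>carrier := E\<rparr>) \<longleftrightarrow>
    (\<forall>x\<in>E. \<forall>y\<in>E. f (x + y) = f x + f y \<and> f (x * y) = f x * f y) \<and> f 1 = 1"
  using assms by (auto simp: ring_iso_def Ring.ring_hom_def Bij_def bij_betw_def)

lemma gal_groupD:
  assumes "f \<in> carrier (gal_group K L)"
  shows "bij_betw f L L" "\<And>x. x \<in> L \<Longrightarrow> f x \<in> L" "\<And>x. x \<in> K \<Longrightarrow> f x = x"
    "\<And>x y. x \<in> L \<Longrightarrow> y \<in> L \<Longrightarrow> f (x + y) = f x + f y"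
    "\<And>x y. x \<in> L \<Longrightarrow> y \<in> L \<Longrightarrow> f (x * y) = f x * f y" "f 1 = 1"
  using assms
  by (auto simp: gal_group_def Bij_ring_iso_CC_iff) (auto simp: Bij_def bij_betw_def)

lemma group_gal_group:
  assumes "subfield L CC" "K \<subseteq> L"
  shows "group (gal_group K L)"
proof -
  note L = subfield_CC_D[OF assms(1)]
  let ?R = "CC\<lparr>carrier := L\<rparr>"
  have "subgroup {f \<in> Bij L. f \<in> ring_iso ?R ?R \<and> (\<forall>x\<in>K. f x = x)} (BijGroup L)"
    (is "subgroup ?G _")
  proof (rule subgroup.intro)
    show "?G \<subseteq> carrier (BijGroup L)" by (auto simp: BijGroup_def)
  next
    fix f g assume fg: "f \<in> ?G" "g \<in> ?G"
    then have "f \<in> L \<rightarrow> L" "g \<in> L \<rightarrow> L" by (auto intro!: Bij_imp_funcset)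
    moreover have "compose L f g \<in> Bij L" using fg by (auto intro: compose_Bij)
    ultimately show "f \<otimes>\<^bsub>BijGroup L\<^esub> g \<in> ?G"
      using fg L assms(2) by (auto simp: BijGroup_def Bij_ring_iso_CC_iff compose_def Pi_iff)
  next
    show "\<one>\<^bsub>BijGroup L\<^esub> \<in> ?G"
      using L assms(2) id_Bij[of L]
      by (auto simp: BijGroup_def Bij_ring_iso_CC_iff)
  next
    fix f assume f: "f \<in> ?G"
    then have b: "f \<in> Bij L" "bij_betw f L L" by (auto simp: Bij_def)
    define g where "g = inv_into L f"
    have g: "bij_betw g L L" unfolding g_def using bij_betw_inv_into[OF b(2)] .
    have gL: "g x \<in> L" and fg: "f (g x) = x" if "x \<in> L" for x
      using that g b(2) by (auto simp: bij_betw_def g_def f_inv_into_f)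
    have hom: "f (x + y) = f x + f y" "f (x * y) = f x * f y" "f 1 = 1" if "x \<in> L" "y \<in> L" for x y
      using f that by (auto simp: Bij_ring_iso_CC_iff)
    have gf: "g (f x) = x" if "x \<in> L" for x
      unfolding g_def using that b(2) by (simp add: bij_betw_def inv_into_f_f)
    have "g (x + y) = g x + g y" "g (x * y) = g x * g y" if "x \<in> L" "y \<in> L" for x y
      using hom[OF gL[OF that(1)] gL[OF that(2)]] that fg gf L gL by metis+
    moreover have "g 1 = 1" using hom(3) gf L(2) by metis
    moreover have "g x = x" if "x \<in> K" for x
      using f that gf[of x] assms(2) by auto
    ultimately have "(\<lambda>x\<in>L. g x) \<in> ?G"
      using L assms(2) restrict_inv_into_Bij[OF b(1)] gL g
      by (auto simp: Bij_ring_iso_CC_iff g_def[symmetric])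
    then show "inv\<^bsub>BijGroup L\<^esub> f \<in> ?G" using inv_BijGroup[OF b(1)] by (simp add: g_def)
  qed
  from subgroup.subgroup_is_group[OF this group_BijGroup]
  show ?thesis by (simp add: gal_group_def)
qed

text \<open>Every automorphism is a word in \<sigma> and its inverse, so induction over
  \<open>generate\<close> shows that all of them fix what \<sigma> fixes; the fixed field of the
  whole group is \<open>K\<close>.\<close>

lemma gal_group_generator_fixed:
  assumes "subfield L CC" "K \<subseteq> L" and "\<sigma> \<in> carrier (gal_group K L)"
    and gen: "subgroup_generated (gal_group K L) {\<sigma>} = gal_group K L"
    and fixed: "{x \<in> L. \<forall>f \<in> carrier (gal_group K L). f x = x} = K"
    and x: "x \<in> L" "\<sigma> x = x"
  shows "x \<in> K"
proof -
  interpret G: group "gal_group K L" by (rule group_gal_group[OF assms(1,2)])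
  have mult: "(f \<otimes>\<^bsub>gal_group K L\<^esub> g) y = f (g y)"
    if "f \<in> carrier (gal_group K L)" "g \<in> carrier (gal_group K L)" "y \<in> L" for f g y
    using that by (auto simp: gal_group_def BijGroup_def compose_def)
  have one_apply: "\<one>\<^bsub>gal_group K L\<^esub> y = y" if "y \<in> L" for y
    using that by (simp add: gal_group_def BijGroup_def)
  have "f x = x" if "f \<in> carrier (gal_group K L)" for f
  proof -
    have "f \<in> generate (gal_group K L) {\<sigma>}"
      using that assms(3) by (subst (asm) gen[symmetric]) (simp add: subgroup_generated_def)
    then show ?thesis
    proof (induction rule: generate.induct)
      case one
      show ?case using one_apply[OF x(1)] .
    next
      case (incl h)
      then show ?case using x by simp
    next
      case (inv h)
      then have [simp]: "h = \<sigma>" by simp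
      have "(inv\<^bsub>gal_group K L\<^esub> \<sigma>) x = (inv\<^bsub>gal_group K L\<^esub> \<sigma>) (\<sigma> x)" using x by simp
      also have "\<dots> = (inv\<^bsub>gal_group K L\<^esub> \<sigma> \<otimes>\<^bsub>gal_group K L\<^esub> \<sigma>) x"
        using mult[of "inv\<^bsub>gal_group K L\<^esub> \<sigma>" \<sigma> x] assms(3) x by simp
      also have "\<dots> = x" using assms(3) one_apply x by simp
      finally show ?case by simp
    next
      case (eng h1 h2)
      have "h1 \<in> carrier (gal_group K L)" "h2 \<in> carrier (gal_group K L)"
        using eng(1,2) G.generate_in_carrier[of "{\<sigma>}"] assms(3) by auto
      then show ?case using mult x eng by simp
    qed
  qed
  then show ?thesis using fixed x by blast
qed

section \<open>Ring endomorphisms of a subfield and their iterates\<close>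

locale subfield_endo =
  fixes L :: "complex set" and f :: "complex \<Rightarrow> complex"
  assumes L: "subfield L CC"
    and closed: "x \<in> L \<Longrightarrow> f x \<in> L"
    and hom_add: "x \<in> L \<Longrightarrow> y \<in> L \<Longrightarrow> f (x + y) = f x + f y"
    and hom_mult: "x \<in> L \<Longrightarrow> y \<in> L \<Longrightarrow> f (x * y) = f x * f y"
    and hom_one: "f 1 = 1"
begin

lemmas L_closed = subfield_CC_D[OF L]

lemma hom_zero: "f 0 = 0"
  using hom_add[of 0 0] L_closed by simp

lemma hom_minus: "x \<in> L \<Longrightarrow> f (- x) = - f x"
  using hom_add[of x "- x"] L_closed hom_zero by (simp add: add_eq_0_iff)

lemma hom_inverse: "x \<in> L \<Longrightarrow> f (inverse x) = inverse (f x)"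
  using hom_mult[of x "inverse x"] L_closed hom_zero hom_one
  by (cases "x = 0") (auto simp: inverse_unique)

lemma L_sum: "(\<And>i. i \<in> A \<Longrightarrow> g i \<in> L) \<Longrightarrow> sum g A \<in> L"
  by (induction A rule: infinite_finite_induct) (auto intro: L_closed)

lemma L_prod: "(\<And>i. i \<in> A \<Longrightarrow> g i \<in> L) \<Longrightarrow> prod g A \<in> L"
  by (induction A rule: infinite_finite_induct) (auto intro: L_closed)

lemma L_of_int: "of_int k \<in> L"
proof -
  have "of_nat n \<in> L" for n by (induction n) (auto intro: L_closed)
  then show ?thesis using L_closed(3) by (cases k rule: int_cases2) auto
qed

lemma L_power: "x \<in> L \<Longrightarrow> x ^ k \<in> L"
  by (induction k) (auto intro: L_closed)

lemma L_powi: "x \<in> L \<Longrightarrow> x powi k \<in> L"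
  by (auto simp: power_int_def intro: L_power L_closed)

lemma hom_sum: "(\<And>i. i \<in> A \<Longrightarrow> g i \<in> L) \<Longrightarrow> f (sum g A) = (\<Sum>i\<in>A. f (g i))"
  by (induction A rule: infinite_finite_induct) (auto simp: hom_zero hom_add L_sum)

lemma hom_prod: "(\<And>i. i \<in> A \<Longrightarrow> g i \<in> L) \<Longrightarrow> f (prod g A) = (\<Prod>i\<in>A. f (g i))"
  by (induction A rule: infinite_finite_induct) (auto simp: hom_one hom_mult L_prod)

lemma hom_of_int: "f (of_int k) = of_int k"
proof -
  have nat: "f (of_nat n) = of_nat n" for n
    using L_of_int[of "int m" for m] by (induction n) (auto simp: hom_zero hom_one hom_add L_closed)
  show ?thesis
    using nat hom_minus L_of_int[of "int m" for m] by (cases k rule: int_cases2) auto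
qed

lemma hom_power: "x \<in> L \<Longrightarrow> f (x ^ k) = f x ^ k"
  by (induction k) (auto simp: hom_one hom_mult L_power)

lemma hom_powi: "x \<in> L \<Longrightarrow> f (x powi k) = f x powi k"
  by (auto simp: power_int_def hom_power hom_inverse L_closed)

lemma algebraic_int_hom:
  assumes "x \<in> L" "algebraic_int x"
  shows "algebraic_int (f x)"
proof -
  obtain P where P: "lead_coeff P = 1" "\<And>i. poly.coeff P i \<in> \<int>" "poly P x = 0"
    using assms(2) by (auto elim: algebraic_int.cases)
  have c: "poly.coeff P i \<in> L" "f (poly.coeff P i) = poly.coeff P i" for i
    using P(2)[of i] L_of_int hom_of_int by (auto elim!: Ints_cases)
  have "poly P (f x) = f (poly P x)"
    using assms(1) c by (simp add: poly_altdef hom_sum hom_mult hom_power L_power L_closed)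
  then show ?thesis
    using P hom_zero by (intro algebraic_int.intros[of P]) auto
qed

lemma det_hom:
  assumes A: "A \<in> carrier_mat m m" and "\<And>i j. i < m \<Longrightarrow> j < m \<Longrightarrow> A $$ (i, j) \<in> L"
  shows "det A \<in> L" "f (det A) = det (map_mat f A)"
proof -
  have sg: "signof q \<in> L" "f (signof q) = signof q" for q
    using L_of_int[of "sign q"] hom_of_int[of "sign q"] by (auto simp: sign_def)
  have *: "q permutes {0..<m} \<Longrightarrow> i < m \<Longrightarrow> A $$ (i, q i) \<in> L" for q i
    using assms(2) permutes_in_image[of q "{0..<m}" i] by auto
  show "det A \<in> L"
    unfolding det_def'[OF A] using * sg by (intro L_sum L_closed(5) L_prod) auto
  have "f (det A) = (\<Sum>q | q permutes {0..<m}. f (signof q * (\<Prod>i=0..<m. A $$ (i, q i))))"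
    unfolding det_def'[OF A] using * sg by (intro hom_sum L_closed(5) L_prod) auto
  also have "\<dots> = (\<Sum>q | q permutes {0..<m}. signof q * (\<Prod>i=0..<m. map_mat f A $$ (i, q i)))"
  proof (intro sum.cong refl)
    fix q assume "q \<in> {q. q permutes {0..<m}}"
    then have q: "q permutes {0..<m}" by simp
    have "f (\<Prod>i=0..<m. A $$ (i, q i)) = (\<Prod>i=0..<m. f (A $$ (i, q i)))"
      using *[OF q] by (intro hom_prod) auto
    also have "\<dots> = (\<Prod>i=0..<m. map_mat f A $$ (i, q i))"
      using A permutes_in_image[OF q] by (intro prod.cong) auto
    finally show "f (signof q * (\<Prod>i=0..<m. A $$ (i, q i)))
        = signof q * (\<Prod>i=0..<m. map_mat f A $$ (i, q i))"
      using sg *[OF q] by (subst hom_mult) (auto intro!: L_prod)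
  qed
  also have "\<dots> = det (map_mat f A)"
    using A by (subst det_def'[of _ m]) auto
  finally show "f (det A) = det (map_mat f A)" .
qed

lemma funpow_closed: "x \<in> L \<Longrightarrow> (f ^^ k) x \<in> L"
  by (induction k) (auto intro: closed)

text \<open>Iterates satisfy the locale again, so each transport fact proved for \<open>f\<close>
  can be applied to the conjugations \<open>\<sigma> ^^ e\<close>.\<close>

lemma funpow_endo: "subfield_endo L (f ^^ k)"
proof (rule subfield_endo.intro)
  show "subfield L CC" by (rule L)
  show "(f ^^ k) 1 = 1" by (induction k) (auto simp: hom_one)
  show "(f ^^ k) x \<in> L" if "x \<in> L" for x using that by (rule funpow_closed)
  show "(f ^^ k) (x + y) = (f ^^ k) x + (f ^^ k) y" if "x \<in> L" "y \<in> L" for x y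
    using that by (induction k) (auto simp: hom_add funpow_closed)
  show "(f ^^ k) (x * y) = (f ^^ k) x * (f ^^ k) y" if "x \<in> L" "y \<in> L" for x y
    using that by (induction k) (auto simp: hom_mult funpow_closed)
qed

lemma map_poly_mult:
  assumes "\<And>i. poly.coeff P i \<in> L" "\<And>i. poly.coeff Q i \<in> L"
  shows "map_poly f (P * Q) = map_poly f P * map_poly f Q"
  using assms
  by (intro poly_eqI) (simp add: coeff_map_poly hom_zero coeff_mult hom_sum hom_mult L_closed)

lemma subfield_fixed: "subfield {x \<in> L. f x = x} CC"
proof -
  interpret field CC by (rule field_CC)
  show ?thesis
    by (intro subfieldI' subringI)
       (auto simp: L_closed hom_zero hom_one hom_add hom_mult hom_minus hom_inverse)
qed

end

context subfield_endo
begin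

lemma hom_diff: "x \<in> L \<Longrightarrow> y \<in> L \<Longrightarrow> f (x - y) = f x - f y"
  using hom_add[of x "- y"] hom_minus[of y] L_closed(3)[of y] by simp

lemma hom_eq_0: "x \<in> L \<Longrightarrow> f x = 0 \<Longrightarrow> x = 0"
  using hom_mult[of x "inverse x"] L_closed hom_one by (cases "x = 0") auto

lemma inj_on_hom: "inj_on f L"
proof (rule inj_onI)
  fix x y assume xy: "x \<in> L" "y \<in> L" "f x = f y"
  then have "x - y \<in> L" using L_closed(3,4)[of y] L_closed(4)[of x "- y"] by simp
  then show "x = y" using hom_eq_0[of "x - y"] hom_diff xy by simp
qed

lemma hom_root:
  assumes "x \<in> L" "\<And>i. poly.coeff P i \<in> L" "\<And>i. f (poly.coeff P i) = poly.coeff P i" "poly P x = 0"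
  shows "poly P (f x) = 0"
proof -
  have "poly P (f x) = f (poly P x)"
    using assms(1-3) by (simp add: poly_altdef hom_sum hom_mult hom_power L_power L_closed)
  then show ?thesis using assms(4) hom_zero by simp
qed

end

text \<open>The \<open>m + 1\<close> iterates of \<alpha> are roots of a polynomial of degree at
  most \<open>m\<close>, so two of them agree and injectivity gives a period
  \<open>s \<le> m\<close> of \<alpha>. The product of the linear factors over one period has
  coefficients fixed by \<open>f\<close>, hence in \<open>K\<close>, and minimality of the degree
  forces \<open>s = m\<close>.\<close>

lemma (in subfield_endo) funpow_dimension:
  assumes K: "subfield K CC" and KL: "K \<subseteq> L" "ring.dimension CC m K L"
    and gen: "L = generate_field CC (insert \<alpha> K)"
    and fixed: "\<And>x. x \<in> K \<Longrightarrow> f x = x" "\<And>x. x \<in> L \<Longrightarrow> f x = x \<Longrightarrow> x \<in> K"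
    and x: "x \<in> L"
  shows "(f ^^ m) x = x"
proof -
  have \<alpha>: "\<alpha> \<in> L" using gen generate_field.incl[of \<alpha> "insert \<alpha> K" CC] by auto
  have K_fixed: "(f ^^ i) y = y" if "y \<in> K" for i y
    using that by (induction i) (auto simp: fixed)
  obtain P :: "complex poly" where P: "P \<noteq> 0" "Polynomial.degree P \<le> m" "poly P \<alpha> = 0" "\<And>i. poly.coeff P i \<in> K"
    using generator_annihilator[OF K L KL gen] by blast
  have root: "poly P ((f ^^ i) \<alpha>) = 0" for i
    using KL(1) P(3,4) K_fixed[OF P(4)] \<alpha>
    by (intro subfield_endo.hom_root[OF funpow_endo]) auto
  have "card ((\<lambda>i. (f ^^ i) \<alpha>) ` {..m}) \<le> card {x. poly P x = 0}"
    using poly_roots_finite[OF P(1)] root by (intro card_mono) auto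
  also have "\<dots> < card {..m}"
    using card_poly_roots_bound[OF P(1)] P(2) by simp
  finally have "\<not> inj_on (\<lambda>i. (f ^^ i) \<alpha>) {..m}" by (rule pigeonhole)
  then obtain i j where ij: "i < j" "j \<le> m" "(f ^^ i) \<alpha> = (f ^^ j) \<alpha>"
    unfolding inj_on_def by (metis atMost_iff linorder_neq_iff)
  define s where "s = j - i"
  have s: "0 < s" "s \<le> m" using ij by (auto simp: s_def)
  have "(f ^^ i) ((f ^^ s) \<alpha>) = (f ^^ i) \<alpha>"
    using ij by (simp add: s_def flip: comp_apply[of "f ^^ i" "f ^^ (j - i)"] funpow_add)
  then have per: "(f ^^ s) \<alpha> = \<alpha>"
    using inj_onD[OF subfield_endo.inj_on_hom[OF funpow_endo[of i]]] funpow_closed \<alpha> by blast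
  define Q where "Q k = (\<Prod>i<k. [:- (f ^^ i) \<alpha>, 1:])" for k
  have lin: "poly.coeff [:- (f ^^ i) \<alpha>, 1:] t \<in> L" for i t
    using funpow_closed[OF \<alpha>] L_closed by (auto simp: coeff_pCons split: nat.split)
  have QL: "poly.coeff (Q k) t \<in> L" for k t
  proof (induction k arbitrary: t)
    case 0
    then show ?case using L_closed by (simp add: Q_def)
  next
    case (Suc k)
    then show ?case
      using lin unfolding Q_def prod.lessThan_Suc coeff_mult
      by (intro L_sum L_closed(5)) auto
  qed
  have "map_poly f (Q k) = (\<Prod>i<k. [:- (f ^^ Suc i) \<alpha>, 1:])" for k
  proof (induction k)
    case 0
    then show ?case by (simp add: Q_def hom_one)
  next
    case (Suc k)
    have "map_poly f (Q (Suc k)) = map_poly f (Q k) * map_poly f [:- (f ^^ k) \<alpha>, 1:]"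
      using map_poly_mult[OF QL lin, of k k] by (simp add: Q_def mult.commute)
    also have "map_poly f [:- (f ^^ k) \<alpha>, 1:] = [:- (f ^^ Suc k) \<alpha>, 1:]"
      using funpow_closed[OF \<alpha>]
      by (intro poly_eqI) (auto simp: coeff_map_poly hom_zero coeff_pCons hom_one hom_minus split: nat.split)
    finally show ?case using Suc by simp
  qed
  \<comment> \<open>Applying \<open>f\<close> moves each factor to the next one, and the last factor
    returns to that of \<alpha> by the period \<open>s\<close>.\<close>
  also have "(\<Prod>i<s. [:- (f ^^ Suc i) \<alpha>, 1:]) = Q s"
  proof -
    obtain r where r: "s = Suc r" using s(1) by (cases s) auto
    have "(\<Prod>i<s. [:- (f ^^ Suc i) \<alpha>, 1:]) = (\<Prod>i<r. [:- (f ^^ Suc i) \<alpha>, 1:]) * [:- \<alpha>, 1:]"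
      using per by (simp only: r prod.lessThan_Suc)
    also have "\<dots> = Q s"
      unfolding Q_def r prod.lessThan_Suc_shift by (simp add: mult.commute)
    finally show ?thesis .
  qed
  finally have "f (poly.coeff (Q s) t) = poly.coeff (Q s) t" for t
    using hom_zero by (metis coeff_map_poly)
  then have QK: "poly.coeff (Q s) t \<in> K" for t using fixed(2) QL by blast
  have deg: "Q k \<noteq> 0 \<and> Polynomial.degree (Q k) = k" for k
  proof -
    have "Q k \<noteq> 0" unfolding Q_def by (simp add: prod_zero_iff)
    then show ?thesis unfolding Q_def by (simp add: degree_prod_eq_sum_degree)
  qed
  have "poly (Q s) \<alpha> = 0"
    using s(1) unfolding Q_def poly_prod by (intro prod_zero bexI[of _ 0]) auto
  then have "m \<le> s"
    using degree_annihilator_ge[OF K L KL gen _ _ QK] deg[of s] by simp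
  then have sm: "(f ^^ m) \<alpha> = \<alpha>" using s per by simp
  \<comment> \<open>The elements fixed by \<open>f ^^ m\<close> form a subfield containing
    \<open>K\<close> and \<alpha>, hence all of \<open>L\<close>.\<close>
  have "subfield {x \<in> L. (f ^^ m) x = x} CC"
    using subfield_endo.subfield_fixed[OF funpow_endo] .
  then have "L \<subseteq> {x \<in> L. (f ^^ m) x = x}"
    unfolding gen using sm \<alpha> KL(1) K_fixed gen
    by (intro generate_field_CC_subset) auto
  then show ?thesis using x by auto
qed

text \<open>The squared absolute value \<open>x * cnj x\<close> is a rational algebraic integer,
  thus an ordinary integer, and it is positive.\<close>

lemma norm_ge_1_imaginary_quadratic:
  assumes "imaginary_quadratic K" "x \<in> K" "algebraic_int x" "algebraic_int (x * cnj x)" "x \<noteq> 0"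
  shows "1 \<le> norm x"
proof -
  have "x * cnj x \<in> \<int>"
    using rational_algebraic_int_is_int imaginary_quadratic_cnj(2)[OF assms(1,2)] assms(4) by blast
  then obtain k where k: "x * cnj x = of_int k" by (auto elim: Ints_cases)
  then have "complex_of_real ((norm x)\<^sup>2) = of_real (of_int k)"
    using complex_norm_square[of x] by simp
  then have nk: "(norm x)\<^sup>2 = of_int k" using of_real_eq_iff by blast
  then have "k > 0" using assms(5) by (metis of_int_0_less_iff zero_less_norm_iff zero_less_power)
  then have "1\<^sup>2 \<le> (norm x)\<^sup>2" using nk by simp
  then show ?thesis by (rule power2_le_imp_le) simp
qed

text \<open>This collects the arithmetic consequences of \<open>suitable\<close> in elementary form:
  \<sigma> has fixed field \<open>K\<close> and order dividing \<open>U * n\<close>, nonzero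
  integers of \<open>K\<close> are bounded away from 0, and \<open>p\<close> is a nonunit that is
  prime in the integers of \<open>L\<close>.\<close>

locale code_field = subfield_endo L \<sigma> for L \<sigma> +
  fixes K :: "complex set" and p :: complex and U n :: nat
  assumes K_subset: "K \<subseteq> L"
    and U_pos: "0 < U" and n_pos: "0 < n"
    and K_fixed: "x \<in> K \<Longrightarrow> \<sigma> x = x"
    and fixed_K: "x \<in> L \<Longrightarrow> \<sigma> x = x \<Longrightarrow> x \<in> K"
    and order: "x \<in> L \<Longrightarrow> (\<sigma> ^^ (U * n)) x = x"
    and norm_K: "x \<in> K \<Longrightarrow> algebraic_int x \<Longrightarrow> x \<noteq> 0 \<Longrightarrow> 1 \<le> norm x"
    and int_add: "x \<in> L \<Longrightarrow> y \<in> L \<Longrightarrow> algebraic_int x \<Longrightarrow> algebraic_int y \<Longrightarrow> algebraic_int (x + y)"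
    and int_mult: "x \<in> L \<Longrightarrow> y \<in> L \<Longrightarrow> algebraic_int x \<Longrightarrow> algebraic_int y \<Longrightarrow> algebraic_int (x * y)"
    and p_K: "p \<in> K" and p_int: "algebraic_int p" and p_norm: "1 < norm p"
    and p_prime: "a \<in> L \<Longrightarrow> b \<in> L \<Longrightarrow> c \<in> L \<Longrightarrow> algebraic_int a \<Longrightarrow> algebraic_int b \<Longrightarrow> algebraic_int c
      \<Longrightarrow> a * b = p * c \<Longrightarrow> \<exists>d\<in>L. algebraic_int d \<and> (a = p * d \<or> b = p * d)"

lemma code_field_suitable:
  assumes "suitable U n K L p \<sigma>" "0 < U" "0 < n"
  shows "code_field L \<sigma> K p U n"
proof -
  from assms(1) have iq: "imaginary_quadratic K" and gal: "galois_extension K L"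
    and dim: "ring.dimension CC (U * n) K L"
    and \<sigma>: "\<sigma> \<in> carrier (gal_group K L)"
    and gen\<sigma>: "subgroup_generated (gal_group K L) {\<sigma>} = gal_group K L" and inert: "inert p K L"
    by (auto simp: suitable_def)
  obtain \<alpha> where \<alpha>: "L = generate_field CC (insert \<alpha> K)" using assms(1) by (auto simp: suitable_def)
  from gal have K: "subfield K CC" and L: "subfield L CC" and KL: "K \<subseteq> L"
    and fixed: "{x \<in> L. \<forall>f \<in> carrier (gal_group K L). f x = x} = K"
    by (auto simp: galois_extension_def)
  note g = gal_groupD[OF \<sigma>]
  have e: "subfield_endo L \<sigma>"
    using L g by (intro subfield_endo.intro) auto
  have fixK: "x \<in> K" if "x \<in> L" "\<sigma> x = x" for x
    using gal_group_generator_fixed[OF L KL \<sigma> gen\<sigma> fixed that] .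
  from inert have p: "p \<in> K" "algebraic_int p" "p \<noteq> 0"
    and prim: "primeideal (PIdl\<^bsub>int_ring_of L\<^esub> p) (int_ring_of L)"
    by (auto simp: inert_def int_ring_of_def)
  have simps: "carrier (int_ring_of E) = {x \<in> E. algebraic_int x}"
    "x \<otimes>\<^bsub>int_ring_of E\<^esub> y = x * y" "x \<oplus>\<^bsub>int_ring_of E\<^esub> y = x + y" for E x y
    by (auto simp: int_ring_of_def)
  have PI: "x \<in> PIdl\<^bsub>int_ring_of L\<^esub> p \<longleftrightarrow> (\<exists>d\<in>L. algebraic_int d \<and> x = p * d)" for x
    by (auto simp: cgenideal_def simps mult.commute)
  \<comment> \<open>Primality of an ideal includes that the ambient structure is a commutative ring;
    closure of the algebraic integers in \<open>L\<close> under sums and products is read off from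
    this.\<close>
  have OL: "cring (int_ring_of L)" using prim by (rule primeideal.axioms)
  note OL_ring = cring.axioms(1)[OF OL]
  have int_mult: "algebraic_int (x * y)" if "x \<in> L" "y \<in> L" "algebraic_int x" "algebraic_int y" for x y
    using ring.ring_simprules(5)[OF OL_ring, of x y] that by (simp add: simps)
  have int_add: "algebraic_int (x + y)" if "x \<in> L" "y \<in> L" "algebraic_int x" "algebraic_int y" for x y
    using ring.ring_simprules(1)[OF OL_ring, of x y] that by (simp add: simps)
  have cnjK: "cnj x \<in> K" if "x \<in> K" for x using imaginary_quadratic_cnj(1)[OF iq that] .
  have norm_K: "1 \<le> norm x" if "x \<in> K" "algebraic_int x" "x \<noteq> 0" for x
  proof -
    have "x \<in> L" "cnj x \<in> L" using that(1) cnjK[OF that(1)] KL by auto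
    then show ?thesis
      using norm_ge_1_imaginary_quadratic[OF iq that(1,2) int_mult that(3)] that(2) by simp
  qed
  \<comment> \<open>If \<open>norm p\<close> were 1, then \<open>cnj p\<close> would be an inverse
    of \<open>p\<close> among the integers of \<open>L\<close>, and the ideal of \<open>p\<close>
    would be the whole ring.\<close>
  have "norm p \<noteq> 1"
  proof
    assume "norm p = 1"
    then have pp: "p * cnj p = 1" using complex_norm_square[of p] by simp
    have "x \<in> PIdl\<^bsub>int_ring_of L\<^esub> p" if "x \<in> L" "algebraic_int x" for x
    proof -
      have c: "cnj p \<in> L" using cnjK[OF p(1)] KL by auto
      have "algebraic_int (cnj p * x)" using int_mult[OF c that(1) algebraic_int_cnj[OF p(2)] that(2)] .
      moreover have "x = p * (cnj p * x)" by (simp only: mult.assoc[symmetric] pp mult_1)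
      ultimately show ?thesis
        unfolding PI using subfield_CC_D(5)[OF L c that(1)] by blast
    qed
    then have "carrier (int_ring_of L) = PIdl\<^bsub>int_ring_of L\<^esub> p"
      using additive_subgroup.a_subset[OF ideal.axioms(1)[OF primeideal.axioms(1)[OF prim]]]
      by (auto simp: simps)
    then show False using primeideal.I_notcarr[OF prim] by simp
  qed
  then have pn: "1 < norm p" using norm_K[OF p] by linarith
  have prime: "\<exists>d\<in>L. algebraic_int d \<and> (a = p * d \<or> b = p * d)"
    if abc: "a \<in> L" "b \<in> L" "c \<in> L" "algebraic_int a" "algebraic_int b" "algebraic_int c" "a * b = p * c" for a b c
  proof -
    have "a * b \<in> PIdl\<^bsub>int_ring_of L\<^esub> p"
      unfolding PI using abc by blast
    then have "a \<in> PIdl\<^bsub>int_ring_of L\<^esub> p \<or> b \<in> PIdl\<^bsub>int_ring_of L\<^esub> p"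
      using primeideal.I_prime[OF prim, of a b] abc(1,2,4,5) by (simp add: simps)
    then show ?thesis unfolding PI by blast
  qed
  note ord = subfield_endo.funpow_dimension[OF e K KL dim \<alpha> g(3) fixK]
  have "code_field_axioms L \<sigma> K p U n"
    by (rule code_field_axioms.intro[OF KL assms(2,3) g(3) fixK ord norm_K int_add int_mult p(1,2) pn prime])
  then show ?thesis using e by (intro code_field.intro)
qed

section \<open>Valuations at the inert prime\<close>

context code_field
begin

abbreviation OL :: "complex set" where
  "OL \<equiv> {x \<in> L. algebraic_int x}"

definition p_dvd :: "complex \<Rightarrow> bool" where
  "p_dvd x \<longleftrightarrow> (\<exists>z\<in>OL. x = p * z)"

lemma p_L: "p \<in> L" and p_nz: "p \<noteq> 0"
  using p_K K_subset p_norm by auto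

lemma OL_p: "p \<in> OL"
  using p_L p_int by simp

lemma OL_of_int: "of_int k \<in> OL"
  using L_of_int by (simp add: int_imp_algebraic_int)

lemma OL_0: "0 \<in> OL" and OL_1: "1 \<in> OL"
  using OL_of_int[of 0] OL_of_int[of 1] by simp_all

lemma OL_add: "x \<in> OL \<Longrightarrow> y \<in> OL \<Longrightarrow> x + y \<in> OL"
  and OL_mult: "x \<in> OL \<Longrightarrow> y \<in> OL \<Longrightarrow> x * y \<in> OL"
  using L_closed int_add int_mult by simp_all

lemma OL_sum: "(\<And>i. i \<in> A \<Longrightarrow> g i \<in> OL) \<Longrightarrow> sum g A \<in> OL"
  by (induction A rule: infinite_finite_induct) (use OL_0 OL_add in \<open>simp_all del: mem_Collect_eq\<close>)

lemma OL_prod: "(\<And>i. i \<in> A \<Longrightarrow> g i \<in> OL) \<Longrightarrow> prod g A \<in> OL"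
  by (induction A rule: infinite_finite_induct) (use OL_1 OL_mult in \<open>simp_all del: mem_Collect_eq\<close>)

lemma OL_power: "x \<in> OL \<Longrightarrow> x ^ k \<in> OL"
  by (induction k) (use OL_1 OL_mult in \<open>simp_all del: mem_Collect_eq\<close>)

lemma OL_signof: "signof q \<in> OL"
  using OL_1 OL_of_int[of "-1"] by (simp add: sign_def)

lemma OL_det:
  assumes "A \<in> carrier_mat m m" "\<And>i j. i < m \<Longrightarrow> j < m \<Longrightarrow> A $$ (i, j) \<in> OL"
  shows "det A \<in> OL"
  unfolding det_def'[OF assms(1)]
proof (intro OL_sum OL_mult OL_signof OL_prod assms(2))
  fix q i assume "q \<in> {q. q permutes {0..<m}}" "i \<in> {0..<m}"
  then show "q i < m" "i < m" using permutes_in_image[of q "{0..<m}" i] by auto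
qed

lemma OL_funpow: "x \<in> OL \<Longrightarrow> (\<sigma> ^^ e) x \<in> OL"
  using subfield_endo.algebraic_int_hom[OF funpow_endo] funpow_closed by simp

lemma funpow_K: "x \<in> K \<Longrightarrow> (\<sigma> ^^ e) x = x"
  by (induction e) (auto simp: K_fixed)

text \<open>When \<open>\<sigma> ^^ d\<close> fixes \<open>x\<close>, applying \<sigma> permutes the
  \<open>d\<close> factors cyclically, so the product is a nonzero integer of \<open>K\<close>. The
  case \<open>d = U * n\<close> bounds valuations, the case \<open>d = U\<close> bounds
  determinants.\<close>

lemma norm_prod_conjugates:
  assumes "x \<in> OL" "x \<noteq> 0" "(\<sigma> ^^ d) x = x" "0 < d"
  shows "1 \<le> norm (\<Prod>e<d. (\<sigma> ^^ e) x)"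
proof -
  let ?N = "\<Prod>e<d. (\<sigma> ^^ e) x"
  obtain r where r: "d = Suc r" using assms(4) by (cases d) auto
  have O: "(\<sigma> ^^ e) x \<in> OL" for e using OL_funpow[OF assms(1)] .
  have N: "?N \<in> OL" using O by (intro OL_prod)
  have "\<sigma> ?N = (\<Prod>e<d. (\<sigma> ^^ Suc e) x)"
    using O by (subst hom_prod) auto
  also have "\<dots> = (\<Prod>e<r. (\<sigma> ^^ Suc e) x) * x"
    using assms(3) by (simp only: r prod.lessThan_Suc)
  also have "\<dots> = ?N"
    unfolding r prod.lessThan_Suc_shift by (simp add: mult.commute)
  finally have "?N \<in> K" using fixed_K N by blast
  moreover have "(\<sigma> ^^ e) x \<noteq> 0" for e
    using subfield_endo.hom_eq_0[OF funpow_endo, of x e] assms(1,2) by auto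
  then have "?N \<noteq> 0" by simp
  ultimately show ?thesis using norm_K N by blast
qed

text \<open>An integral inverse of \<open>p\<close> would be fixed by \<sigma>, hence lie in
  \<open>K\<close> and have absolute value at least 1, although \<open>norm p\<close> exceeds
  1.\<close>

lemma not_p_dvd_1: "\<not> p_dvd 1"
proof
  assume "p_dvd 1"
  then obtain z where z: "z \<in> OL" "1 = p * z" by (auto simp: p_dvd_def)
  then have "z = inverse p" by (metis inverse_unique)
  then have "z \<in> K"
    using fixed_K[of z] z hom_inverse[OF p_L] K_fixed[OF p_K] by auto
  moreover have "z \<noteq> 0" "algebraic_int z" using z by auto
  ultimately have "1 \<le> norm z" by (intro norm_K)
  then have "norm p * 1 \<le> norm p * norm z" by (intro mult_left_mono) auto
  moreover have "norm p * norm z = 1" using z(2) by (metis norm_mult norm_one)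
  ultimately show False using p_norm by simp
qed

lemma p_dvd_mult:
  assumes "x \<in> OL" "y \<in> OL" "p_dvd (x * y)"
  shows "p_dvd x \<or> p_dvd y"
  using assms p_prime[of x y] unfolding p_dvd_def by blast

lemma not_p_dvd_prod:
  assumes "finite A" "\<And>i. i \<in> A \<Longrightarrow> g i \<in> OL" "\<And>i. i \<in> A \<Longrightarrow> \<not> p_dvd (g i)"
  shows "\<not> p_dvd (prod g A)"
  using assms
proof (induction A rule: finite_induct)
  case empty
  then show ?case using not_p_dvd_1 by simp
next
  case (insert i A)
  have "prod g A \<in> OL" using insert.prems by (intro OL_prod) blast
  moreover have "\<not> p_dvd (prod g A)" using insert by blast
  moreover have "g i \<in> OL" "\<not> p_dvd (g i)" using insert.prems by blast+
  ultimately have "\<not> p_dvd (g i * prod g A)" using p_dvd_mult by blast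
  then show ?case using insert.hyps by simp
qed

text \<open>\<sigma> fixes \<open>p\<close> and is undone by its iterate \<open>U * n - 1\<close>,
  so divisibility of an image by \<open>p\<close> pulls back.\<close>

lemma not_p_dvd_funpow:
  assumes "y \<in> OL" "\<not> p_dvd y"
  shows "\<not> p_dvd ((\<sigma> ^^ e) y)"
proof (induction e)
  case 0
  then show ?case using assms by simp
next
  case (Suc e)
  define x where "x = (\<sigma> ^^ e) y"
  have x: "x \<in> OL" using OL_funpow[OF assms(1)] by (simp only: x_def)
  show ?case
  proof
    assume "p_dvd ((\<sigma> ^^ Suc e) y)"
    then obtain z where z: "z \<in> OL" "\<sigma> x = p * z" by (auto simp: p_dvd_def x_def)
    define d where "d = U * n - 1"
    have d: "U * n = Suc d" using U_pos n_pos by (simp add: d_def)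
    have "x = (\<sigma> ^^ d) (\<sigma> x)" using order[of x] x unfolding d funpow_Suc_right by simp
    also have "\<dots> = p * (\<sigma> ^^ d) z"
      using z subfield_endo.hom_mult[OF funpow_endo, of p z d] p_L funpow_K[OF p_K] by simp
    finally have "p_dvd x" using OL_funpow[OF z(1), of d] by (auto simp: p_dvd_def)
    then show False using Suc.IH by (simp add: x_def)
  qed
qed

text \<open>If \<open>p ^ v\<close> divides \<open>x\<close>, then the product of all
  \<open>U * n\<close> conjugates of \<open>x\<close> has absolute value at least
  \<open>norm p ^ (v * (U * n))\<close>. This bounds \<open>v\<close>, and the cofactor for the
  largest \<open>v\<close> is not divisible by \<open>p\<close>.\<close>

lemma p_valuation:
  assumes "x \<in> OL" "x \<noteq> 0"
  obtains v y where "x = p ^ v * y" "y \<in> OL" "\<not> p_dvd y"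
proof -
  let ?d = "U * n"
  let ?N = "\<lambda>z. norm (\<Prod>e<?d. (\<sigma> ^^ e) z)"
  define P where "P v \<longleftrightarrow> (\<exists>y\<in>OL. x = p ^ v * y)" for v
  obtain b where b: "?N x < norm p ^ b" using real_arch_pow[OF p_norm] by blast
  have bound: "v \<le> b" if v: "P v" for v
  proof -
    obtain y where y: "y \<in> OL" "x = p ^ v * y" using v unfolding P_def by blast
    have "(\<sigma> ^^ e) x = p ^ v * (\<sigma> ^^ e) y" for e
      using y p_L L_power funpow_K[OF p_K] subfield_endo.hom_mult[OF funpow_endo, of "p ^ v" y e]
        subfield_endo.hom_power[OF funpow_endo, of p e v] by simp
    then have "?N x = norm p ^ (v * ?d) * ?N y"
      by (simp add: prod.distrib norm_mult norm_power power_mult prod_norm)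
    moreover have "1 \<le> ?N y"
      using norm_prod_conjugates[of y ?d] y order[of y] U_pos n_pos assms(2) by auto
    ultimately have "norm p ^ (v * ?d) \<le> ?N x"
      using p_norm by (simp add: mult_le_cancel_left1)
    moreover have "norm p ^ v \<le> norm p ^ (v * ?d)"
      using p_norm U_pos n_pos by (intro power_increasing) auto
    ultimately have "norm p ^ v < norm p ^ b" using b by linarith
    then show "v \<le> b" using p_norm power_less_imp_less_exp[of "norm p" v b] by simp
  qed
  have "P 0" unfolding P_def using assms(1) by (intro bexI[of _ x]) simp_all
  then obtain v where v: "P v" "\<And>w. P w \<Longrightarrow> w \<le> v"
    using Nat.ex_has_greatest_nat[of P 0 b] bound by blast
  then obtain y where y: "y \<in> OL" "x = p ^ v * y" unfolding P_def by blast
  have "\<not> p_dvd y"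
  proof
    assume "p_dvd y"
    then obtain z where z: "z \<in> OL" "y = p * z" unfolding p_dvd_def by blast
    have "x = p ^ Suc v * z" unfolding y(2) z(2) by simp
    then have "P (Suc v)" unfolding P_def using z(1) by blast
    then have "Suc v \<le> v" by (rule v(2))
    then show False by simp
  qed
  then show ?thesis by (rule that[OF y(2,1)])
qed

text \<open>The Leibniz terms of \<open>det A\<close> have \<open>p\<close>-adic valuation at least
  \<open>(\<Sum>i. r i + s i) / N\<close>, with equality only for the permutation \<open>\<pi>\<close>, so they cannot cancel.\<close>

lemma det_nonzero_unique_minimum:
  fixes E :: "nat \<Rightarrow> nat \<Rightarrow> int" and r s :: "nat \<Rightarrow> int" and N :: int
  assumes A: "A \<in> carrier_mat m m" and \<pi>: "\<pi> permutes {0..<m}" and N: "0 < N"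
    and Aij: "\<And>i j. i < m \<Longrightarrow> j < m \<Longrightarrow> A $$ (i, j) = p powi E i j * y i j"
    and y: "\<And>i j. i < m \<Longrightarrow> j < m \<Longrightarrow> y i j \<in> OL"
    and eq: "\<And>i. i < m \<Longrightarrow> N * E i (\<pi> i) = r i + s (\<pi> i)"
    and gt: "\<And>i j. i < m \<Longrightarrow> j < m \<Longrightarrow> j \<noteq> \<pi> i \<Longrightarrow> r i + s j < N * E i j"
    and nd: "\<And>i. i < m \<Longrightarrow> \<not> p_dvd (y i (\<pi> i))"
  shows "det A \<noteq> 0"
proof
  assume det0: "det A = 0"
  define P where "P = {q. q permutes {0..<m}}"
  define e where "e q = (\<Sum>i=0..<m. E i (q i))" for q
  define Y where "Y q = (\<Prod>i=0..<m. y i (q i))" for q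
  have P: "finite P" "\<pi> \<in> P" using \<pi> by (auto simp: P_def finite_permutations)
  have img: "q i < m" if "q \<in> P" "i < m" for q i
    using that permutes_in_image[of q "{0..<m}" i] by (auto simp: P_def)
  have Y: "Y q \<in> OL" if "q \<in> P" for q
    unfolding Y_def using y img[OF that] by (intro OL_prod) auto
  \<comment> \<open>The potentials \<open>r\<close> and \<open>s\<close> have the same total along
    every permutation, so only the excess of \<open>N * E i j\<close> over \<open>r i + s j\<close>
    distinguishes the Leibniz terms.\<close>
  have sumrs: "(\<Sum>i=0..<m. r i + s (q i)) = sum r {0..<m} + sum s {0..<m}" if "q \<in> P" for q
    using that sum.permute[of q "{0..<m}" s] by (simp add: P_def sum.distrib comp_def)
  have e_gt: "e \<pi> < e q" if q: "q \<in> P" "q \<noteq> \<pi>" for q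
  proof -
    obtain i where i: "q i \<noteq> \<pi> i" using q(2) by (meson ext)
    have "i < m"
    proof (rule ccontr)
      assume "\<not> i < m"
      then have "q i = i" "\<pi> i = i"
        using q(1) P(2) by (auto simp: P_def permutes_not_in)
      then show False using i by simp
    qed
    have "(\<Sum>i=0..<m. r i + s (q i)) < (\<Sum>i=0..<m. N * E i (q i))"
    proof (rule sum_strict_mono_ex1)
      show "\<forall>i\<in>{0..<m}. r i + s (q i) \<le> N * E i (q i)"
      proof
        fix i assume "i \<in> {0..<m}"
        then show "r i + s (q i) \<le> N * E i (q i)"
          using gt[of i "q i"] eq[of i] img[OF q(1)] by (cases "q i = \<pi> i") auto
      qed
      show "\<exists>i\<in>{0..<m}. r i + s (q i) < N * E i (q i)"
        using gt[of i "q i"] i \<open>i < m\<close> img[OF q(1)] by auto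
    qed simp
    moreover have "(\<Sum>i=0..<m. r i + s (\<pi> i)) = (\<Sum>i=0..<m. N * E i (\<pi> i))"
      using eq by (intro sum.cong) auto
    ultimately have "N * e \<pi> < N * e q"
      using sumrs[OF P(2)] sumrs[OF q(1)] by (simp add: e_def sum_distrib_left)
    then show ?thesis using N by simp
  qed
  have leibniz: "(\<Prod>i=0..<m. A $$ (i, q i)) = p powi e q * Y q" if q: "q \<in> P" for q
  proof -
    have "(\<Prod>i=0..<m. A $$ (i, q i)) = (\<Prod>i=0..<m. p powi E i (q i) * y i (q i))"
      using Aij img[OF q] by (intro prod.cong) auto
    also have "(\<Prod>i\<in>S. p powi E i (q i)) = p powi (\<Sum>i\<in>S. E i (q i))" if "finite S" for S
      using that p_nz by (induction S rule: finite_induct) (auto simp: power_int_add)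
    then have "(\<Prod>i=0..<m. p powi E i (q i) * y i (q i)) = p powi e q * Y q"
      by (simp add: prod.distrib e_def Y_def)
    finally show ?thesis .
  qed
  \<comment> \<open>\<open>T\<close> is the sum of the remaining terms after division by
    \<open>p powi (e \<pi> + 1)\<close>; it is integral because \<open>e q\<close> is at least
    \<open>e \<pi> + 1\<close> there.\<close>
  define T where "T = (\<Sum>q\<in>P - {\<pi>}. signof q * (p ^ nat (e q - e \<pi> - 1) * Y q))"
  have T: "T \<in> OL"
    unfolding T_def using Y by (intro OL_sum OL_mult OL_signof OL_power OL_p) auto
  have "det A = (\<Sum>q\<in>P. signof q * (p powi e q * Y q))"
    unfolding det_def'[OF A] P_def[symmetric] by (intro sum.cong) (auto simp: leibniz)
  also have "\<dots> = (\<Sum>q\<in>P - {\<pi>}. signof q * (p powi e q * Y q)) + signof \<pi> * (p powi e \<pi> * Y \<pi>)"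
    using P by (simp add: sum.remove[of P \<pi>] add.commute)
  also have "(\<Sum>q\<in>P - {\<pi>}. signof q * (p powi e q * Y q)) = p powi e \<pi> * (p * T)"
    unfolding T_def sum_distrib_left
  proof (intro sum.cong refl)
    fix q assume "q \<in> P - {\<pi>}"
    then have "e q = e \<pi> + (1 + int (nat (e q - e \<pi> - 1)))" using e_gt[of q] by auto
    then have "p powi e q = p powi e \<pi> * (p * p ^ nat (e q - e \<pi> - 1))"
      using p_nz by (metis power_int_add power_int_1_right power_int_of_nat)
    then show "signof q * (p powi e q * Y q) =
        p powi e \<pi> * (p * (signof q * (p ^ nat (e q - e \<pi> - 1) * Y q)))"
      by (simp add: mult_ac)
  qed
  finally have "p powi e \<pi> * (p * T + signof \<pi> * Y \<pi>) = 0"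
    using det0 by (simp add: algebra_simps)
  then have "p * T + signof \<pi> * Y \<pi> = 0" using p_nz by simp
  then have sY: "signof \<pi> * Y \<pi> = p * (- 1 * T)" by (simp add: eq_neg_iff_add_eq_0 add.commute)
  \<comment> \<open>Signs square to 1, so the sign can be moved to the other side without leaving
    the integers.\<close>
  have "Y \<pi> = signof \<pi> * (signof \<pi> * Y \<pi>)" by (simp add: sign_def)
  also have "\<dots> = p * (signof \<pi> * (of_int (- 1) * T))" by (simp only: sY) simp
  finally have "p_dvd (Y \<pi>)"
    unfolding p_dvd_def using OL_mult[OF OL_signof[of \<pi>] OL_mult[OF OL_of_int T]] by blast
  moreover have "\<not> p_dvd (Y \<pi>)"
    unfolding Y_def using y nd img[OF P(2)] by (intro not_p_dvd_prod) auto
  ultimately show False by simp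
qed

text \<open>The quantities \<open>n * v d + d\<close> differ for different \<open>d\<close> because
  their residues modulo \<open>n\<close> do, so a minimum over the nonzero coefficients is strict.
  The index \<open>d\<close> stands for \<open>h - 1\<close>.\<close>

lemma code_valuation:
  assumes "\<And>h. h \<in> {1..n} \<Longrightarrow> x h \<in> OL" "\<exists>h\<in>{1..n}. x h \<noteq> 0"
  obtains v :: "nat \<Rightarrow> nat" and y d0 where "d0 < n" "\<not> p_dvd (y d0)"
    "\<And>d. d < n \<Longrightarrow> x (Suc d) = p ^ v d * y d" "\<And>d. d < n \<Longrightarrow> y d \<in> OL"
    "\<And>d. d < n \<Longrightarrow> d \<noteq> d0 \<Longrightarrow> n * v d0 + d0 < n * v d + d"
proof -
  define S where "S = {d. d < n \<and> x (Suc d) \<noteq> 0}"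
  have S: "finite S" "S \<noteq> {}"
  proof -
    obtain h where "h \<in> {1..n}" "x h \<noteq> 0" using assms(2) by blast
    then have "h - 1 \<in> S" by (auto simp: S_def)
    then show "S \<noteq> {}" by blast
  qed (simp add: S_def)
  have "\<exists>v y. x (Suc d) = p ^ v * y \<and> y \<in> OL \<and> \<not> p_dvd y" if "d \<in> S" for d
  proof -
    have "x (Suc d) \<in> OL" "x (Suc d) \<noteq> 0" using assms(1)[of "Suc d"] that by (auto simp: S_def)
    then show ?thesis using p_valuation by metis
  qed
  then obtain v0 y0 where vy: "\<And>d. d \<in> S \<Longrightarrow> x (Suc d) = p ^ v0 d * y0 d \<and> y0 d \<in> OL \<and> \<not> p_dvd (y0 d)"
    by metis
  define d0 where "d0 = arg_min_on (\<lambda>d. n * v0 d + d) S"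
  have d0: "d0 \<in> S" "\<And>d. d \<in> S \<Longrightarrow> n * v0 d0 + d0 \<le> n * v0 d + d"
    using arg_min_if_finite(1)[OF S] arg_min_least[OF S] by (auto simp: d0_def)
  \<comment> \<open>A zero coefficient is written as a power of \<open>p\<close> times 0. The
    exponent \<open>Suc (v0 d0)\<close> lets it lose the comparison, since
    \<open>d0 < n\<close>.\<close>
  define v where "v d = (if d \<in> S then v0 d else Suc (v0 d0))" for d
  define y where "y d = (if d \<in> S then y0 d else 0)" for d
  show ?thesis
  proof (rule that)
    show lt: "d0 < n" using d0(1) by (simp add: S_def)
    show "\<not> p_dvd (y d0)" using d0(1) vy[of d0] by (simp add: y_def)
    fix d assume d: "d < n"
    show "x (Suc d) = p ^ v d * y d"
      using vy[of d] d by (cases "d \<in> S") (simp_all add: v_def y_def, simp add: S_def)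
    show "y d \<in> OL" using vy[of d] OL_0 by (cases "d \<in> S") (simp_all add: y_def)
    assume ne: "d \<noteq> d0"
    show "n * v d0 + d0 < n * v d + d"
    proof (cases "d \<in> S")
      case True
      have "n * v0 d0 + d0 \<noteq> n * v0 d + d"
      proof
        assume "n * v0 d0 + d0 = n * v0 d + d"
        then have "(n * v0 d0 + d0) mod n = (n * v0 d + d) mod n" by simp
        then show False using d lt ne by simp
      qed
      then show ?thesis using d0(1) d0(2)[OF True] True by (simp add: v_def)
    next
      case False
      then show ?thesis using d0(1) lt by (simp add: v_def)
    qed
  qed
qed

end

section \<open>Determinants of code words\<close>

text \<open>Each block of \<open>n\<close> indices is rotated by its own amount. One instance is the
  permutation of the dominant Leibniz term, another the conjugation that realises
  \<open>\<sigma> ^^ U\<close>.\<close>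

definition block_shift :: "nat \<Rightarrow> nat \<Rightarrow> (nat \<Rightarrow> nat) \<Rightarrow> nat \<Rightarrow> nat" where
  "block_shift U n c a =
     (if a < U * n then (a div n) * n + (a mod n + c (a div n)) mod n else a)"

lemma block_shift_div:
  assumes "a < U * n"
  shows "block_shift U n c a div n = a div n"
    and "block_shift U n c a mod n = (a mod n + c (a div n)) mod n"
proof -
  have "0 < n" using assms by (cases n) auto
  then show "block_shift U n c a div n = a div n"
    and "block_shift U n c a mod n = (a mod n + c (a div n)) mod n"
    using assms by (simp_all add: block_shift_def)
qed

lemma mod_add_right_imp_eq_nat:
  fixes i j c n :: nat
  assumes "i < n" "j < n" "(i + c) mod n = (j + c) mod n"
  shows "i = j"
proof -
  \<comment> \<open>Adding \<open>n * c - c\<close> turns the shift by \<open>c\<close> into a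
    multiple of \<open>n\<close> without negative numbers.\<close>
  have "(i + c + (n * c - c)) mod n = (j + c + (n * c - c)) mod n"
    using assms(3) by (rule mod_add_cong) simp
  moreover have "c \<le> n * c" using assms(1) by simp
  ultimately show ?thesis using assms(1,2) by simp
qed

lemma less_mult_div_mod:
  fixes a U n :: nat
  assumes "a < U * n"
  shows "a div n < U" "a mod n < n" "0 < n"
proof -
  show "0 < n" using assms by (cases n) auto
  then show "a div n < U" "a mod n < n" using assms by (simp_all add: less_mult_imp_div_less)
qed

lemma block_shift_permutes: "block_shift U n c permutes {0..<U * n}"
proof (rule inj_imp_permutes)
  show "inj_on (block_shift U n c) {0..<U * n}"
  proof (rule inj_onI)
    fix a b assume ab: "a \<in> {0..<U * n}" "b \<in> {0..<U * n}" "block_shift U n c a = block_shift U n c b"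
    then have lt: "a < U * n" "b < U * n" by auto
    have d: "a div n = b div n"
      using block_shift_div(1)[OF lt(1), of c] block_shift_div(1)[OF lt(2), of c] ab(3) by simp
    have "(a mod n + c (a div n)) mod n = (b mod n + c (a div n)) mod n"
      using block_shift_div(2)[OF lt(1), of c] block_shift_div(2)[OF lt(2), of c] ab(3) d by simp
    then have "a mod n = b mod n"
      using mod_add_right_imp_eq_nat less_mult_div_mod(2)[OF lt(1)] less_mult_div_mod(2)[OF lt(2)] by blast
    with d show "a = b" by (metis div_mult_mod_eq)
  qed
  fix a assume "a \<in> {0..<U * n}"
  then have lt: "a < U * n" by simp
  have "(a div n) * n + (a mod n + c (a div n)) mod n < (a div n + 1) * n"
    using less_mult_div_mod(3)[OF lt] by simp
  also have "\<dots> \<le> U * n" using less_mult_div_mod(1)[OF lt] by (intro mult_le_mono1) simp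
  finally show "block_shift U n c a \<in> {0..<U * n}" using lt by (simp add: block_shift_def)
qed (simp_all add: block_shift_def)

text \<open>This is conjugation by a monomial matrix: the row and column permutations contribute the
  same sign twice, and the diagonal scalings cancel.\<close>

lemma det_permute_scale:
  fixes A :: "'a :: comm_ring_1 mat"
  assumes A: "A \<in> carrier_mat m m" and \<rho>: "\<rho> permutes {0..<m}"
    and cg: "\<And>a. a < m \<Longrightarrow> c a * g a = 1"
  shows "det (mat m m (\<lambda>(a, b). c a * A $$ (\<rho> a, \<rho> b) * g b)) = det A"
proof -
  let ?B = "mat m m (\<lambda>(a, b). A $$ (\<rho> a, \<rho> b))"
  have lt: "\<rho> a < m" if "a < m" for a using permutes_in_image[OF \<rho>, of a] that by simp
  have "det (mat m m (\<lambda>(a, b). c a * A $$ (\<rho> a, \<rho> b) * g b)) = det ?B"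
    unfolding det_def'[OF mat_carrier]
  proof (intro sum.cong refl)
    fix q assume "q \<in> {q. q permutes {0..<m}}"
    then have q: "q permutes {0..<m}" by simp
    have q_lt: "q a < m" if "a < m" for a using permutes_in_image[OF q, of a] that by simp
    have "(\<Prod>a=0..<m. mat m m (\<lambda>(a, b). c a * A $$ (\<rho> a, \<rho> b) * g b) $$ (a, q a))
        = (\<Prod>a=0..<m. c a * ?B $$ (a, q a) * g (q a))"
      using q_lt by (intro prod.cong) auto
    also have "\<dots> = prod c {0..<m} * (\<Prod>a=0..<m. ?B $$ (a, q a)) * (\<Prod>a=0..<m. g (q a))"
      by (simp add: prod.distrib)
    also have "(\<Prod>a=0..<m. g (q a)) = prod g {0..<m}"
      using prod.permute[OF q, of g] by (simp add: comp_def)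
    also have "prod c {0..<m} * (\<Prod>a=0..<m. ?B $$ (a, q a)) * prod g {0..<m}
        = (\<Prod>a=0..<m. c a * g a) * (\<Prod>a=0..<m. ?B $$ (a, q a))"
      by (simp add: prod.distrib mult_ac)
    also have "(\<Prod>a=0..<m. c a * g a) = 1" using cg by (intro prod.neutral) auto
    finally show "signof q * (\<Prod>a=0..<m. mat m m (\<lambda>(a, b). c a * A $$ (\<rho> a, \<rho> b) * g b) $$ (a, q a))
        = signof q * (\<Prod>a=0..<m. ?B $$ (a, q a))" by simp
  qed
  also have "det ?B = det A"
  proof -
    let ?C = "mat m m (\<lambda>(a, b). A $$ (\<rho> a, b))"
    have "?B = transpose_mat (mat m m (\<lambda>(a, b). transpose_mat ?C $$ (\<rho> a, b)))"
      using lt by (intro eq_matI) auto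
    then have "det ?B = det (mat m m (\<lambda>(a, b). transpose_mat ?C $$ (\<rho> a, b)))"
      by (simp add: det_transpose[of _ m])
    also have "\<dots> = signof \<rho> * det ?C"
      by (subst det_permute_rows[OF _ \<rho>]) (simp_all add: det_transpose[of _ m])
    also have "det ?C = signof \<rho> * det A" by (rule det_permute_rows[OF A \<rho>])
    finally show ?thesis by (simp add: sign_def)
  qed
  finally show ?thesis .
qed

text \<open>The residue of \<open>i - j\<close> modulo \<open>n\<close>, written for natural
  numbers; the coefficient in entry \<open>(i, j)\<close> of a code matrix has number
  \<open>Suc (circ n i j)\<close>.\<close>

definition circ :: "nat \<Rightarrow> nat \<Rightarrow> nat \<Rightarrow> nat" where
  "circ n i j = (if j \<le> i then i - j else i + n - j)"

text \<open>Besides a conjugate of a coefficient \<open>x\<^sub>h\<close>, the entry \<open>(a, b)\<close> of a code word contains a power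
  of \<open>p\<close> coming from the diagonal blocks and from the wrap-around in the cyclic algebra.\<close>

definition code_exponent :: "nat \<Rightarrow> int \<Rightarrow> nat \<Rightarrow> nat \<Rightarrow> int" where
  "code_exponent n k a b =
     (if b div n = a div n then - k else 0) + (if b mod n \<le> a mod n then 0 else 1)"

lemma circ_less: "i < n \<Longrightarrow> j < n \<Longrightarrow> circ n i j < n"
  by (auto simp: circ_def)

lemma Suc_mod_if: "i < n \<Longrightarrow> (i + 1) mod n = (if i = n - 1 then 0 else i + 1)" for i n :: nat
  by simp

lemma circ_Suc_mod:
  assumes "i < n" "j < n"
  shows "circ n ((i + 1) mod n) ((j + 1) mod n) = circ n i j"
  using assms unfolding circ_def Suc_mod_if[OF assms(1)] Suc_mod_if[OF assms(2)]
  by (simp split: if_split) arith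

text \<open>Rotating both indices alters the wrap-around bit exactly when one of them, but not both,
  leaves the last position. The two correction terms become the row and column scalings of the
  conjugation.\<close>

lemma wrap_Suc_mod:
  fixes i j n :: nat
  assumes "i < n" "j < n"
  shows "(if j \<le> i then 0 else 1 :: int) = (if i = n - 1 then - 1 else 0) +
    (if (j + 1) mod n \<le> (i + 1) mod n then 0 else 1) + (if j = n - 1 then 1 else 0)"
  using assms unfolding Suc_mod_if[OF assms(1)] Suc_mod_if[OF assms(2)]
  by (simp split: if_split) arith

text \<open>In each row every coefficient occurs in exactly one column; the rotation by
  \<open>n - d\<close> locates it.\<close>

lemma circ_eq_iff:
  assumes "i < n" "j < n" "d < n"
  shows "circ n i j = d \<longleftrightarrow> j = (i + (n - d)) mod n"
proof -
  have "(i + (n - d)) mod n = (if d \<le> i then i - d else i + n - d)"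
  proof (cases "d \<le> i")
    case True
    then have "i + (n - d) = (i - d) + n" using assms by simp
    then have "(i + (n - d)) mod n = (i - d) mod n" by simp
    then show ?thesis using True assms by simp
  qed (use assms in simp)
  then show ?thesis using assms unfolding circ_def by (simp split: if_split) arith
qed

lemma code_matrix_index:
  assumes "i < n" "j < n"
  shows "code_matrix n p \<tau> x $$ (i, j) = p ^ (if j \<le> i then 0 else 1) * (\<tau> ^^ j) (x (Suc (circ n i j)))"
  using assms by (auto simp: code_matrix_def circ_def Suc_diff_le)

context code_field
begin

lemma L_if_OL: "x \<in> OL \<Longrightarrow> x \<in> L" by simp

lemma funpow_p_powi: "(\<sigma> ^^ e) (p powi k) = p powi k"
  using subfield_endo.hom_powi[OF funpow_endo, OF p_L] funpow_K[OF p_K] by simp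

text \<open>The block conjugation and the power of \<open>\<sigma> ^^ U\<close> inside the block
  merge into one iterate of \<sigma>, because all powers of \<open>p\<close> are fixed.\<close>

lemma user_matrix_index:
  assumes x: "\<And>h. h \<in> {1..n} \<Longrightarrow> x h \<in> OL" and s: "s < n" and b: "b < U * n"
  shows "user_matrix U n p \<sigma> k (Suc j) (code_matrix n p (\<sigma> ^^ U) x) $$ (s, b) =
    p powi ((if b div n = j then - k else 0) + (if b mod n \<le> s then 0 else 1)) *
    (\<sigma> ^^ (b div n + U * (b mod n))) (x (Suc (circ n s (b mod n))))"
proof -
  let ?M = "code_matrix n p (\<sigma> ^^ U) x" and ?l = "b div n" and ?i = "b mod n"
  have i: "?i < n" using less_mult_div_mod[OF b] by simp
  have xL: "x (Suc (circ n s ?i)) \<in> L"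
    using x[of "Suc (circ n s ?i)"] circ_less[OF s i] by simp
  have M: "?M \<in> carrier_mat n n" by (simp add: code_matrix_def)
  have "map_mat (\<sigma> ^^ ?l) ?M $$ (s, ?i) = (\<sigma> ^^ ?l) (?M $$ (s, ?i))"
    using M s i by simp
  also have "\<dots> = (\<sigma> ^^ ?l) (p powi (if ?i \<le> s then 0 else 1) * (\<sigma> ^^ (U * ?i)) (x (Suc (circ n s ?i))))"
    using s i by (simp add: code_matrix_index funpow_mult)
  also have "\<dots> = p powi (if ?i \<le> s then 0 else 1) * (\<sigma> ^^ ?l) ((\<sigma> ^^ (U * ?i)) (x (Suc (circ n s ?i))))"
    using subfield_endo.hom_mult[OF funpow_endo[of ?l]] L_powi[OF p_L] funpow_closed[OF xL]
      funpow_p_powi[of ?l] by metis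
  finally have "map_mat (\<sigma> ^^ ?l) ?M $$ (s, ?i) =
      p powi (if ?i \<le> s then 0 else 1) * (\<sigma> ^^ (?l + U * ?i)) (x (Suc (circ n s ?i)))"
    by (simp add: funpow_add)
  then show ?thesis
    using s b p_nz by (simp add: user_matrix_def Let_def power_int_add)
qed

end

text \<open>Here the users, the first argument of \<open>x\<close>, are numbered from 0.\<close>

locale code_word = code_field L \<sigma> K p U n for L \<sigma> K p U n +
  fixes k :: int and x :: "nat \<Rightarrow> nat \<Rightarrow> complex" and Z :: "complex mat"
  assumes k: "1 \<le> k"
    and x_OL: "\<And>j h. j < U \<Longrightarrow> h \<in> {1..n} \<Longrightarrow> x j h \<in> OL"
    and x_nz: "\<And>j. j < U \<Longrightarrow> \<exists>h\<in>{1..n}. x j h \<noteq> 0"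
    and Z: "Z \<in> carrier_mat (U * n) (U * n)"
    and Z_index: "\<And>a b. a < U * n \<Longrightarrow> b < U * n \<Longrightarrow> Z $$ (a, b) = p powi code_exponent n k a b *
      (\<sigma> ^^ (b div n + U * (b mod n))) (x (a div n) (Suc (circ n (a mod n) (b mod n))))"
begin

lemma coefficient_OL:
  assumes "a < U * n" "b < U * n"
  shows "x (a div n) (Suc (circ n (a mod n) (b mod n))) \<in> OL"
  using assms less_mult_div_mod circ_less[of "a mod n" n "b mod n"] by (intro x_OL) auto

text \<open>The dominant permutation stays inside the diagonal blocks and picks the coefficient of
  minimal weight in each row of a user. Other columns lose either by a larger weight or by missing
  the factor with exponent \<open>- k\<close>.\<close>

lemma det_nonzero: "det Z \<noteq> 0"
proof -
  define good where "good j v y d0 \<longleftrightarrow> d0 < n \<and> \<not> p_dvd (y d0) \<and>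
      (\<forall>d<n. x j (Suc d) = p ^ v d * y d \<and> y d \<in> OL \<and> (d \<noteq> d0 \<longrightarrow> n * v d0 + d0 < n * v d + d))"
    for j v y d0
  have "\<exists>v y d0. good j v y d0" if j: "j < U" for j
    by (rule code_valuation[OF x_OL[OF j] x_nz[OF j]], assumption, unfold good_def, blast)
  then obtain v y d0 where good: "\<And>j. j < U \<Longrightarrow> good j (v j) (y j) (d0 j)" by metis
  have d0: "\<And>j. j < U \<Longrightarrow> d0 j < n" and nd: "\<And>j. j < U \<Longrightarrow> \<not> p_dvd (y j (d0 j))"
    and vy: "\<And>j d. j < U \<Longrightarrow> d < n \<Longrightarrow> x j (Suc d) = p ^ v j d * y j d"
    and y: "\<And>j d. j < U \<Longrightarrow> d < n \<Longrightarrow> y j d \<in> OL"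
    and min: "\<And>j d. j < U \<Longrightarrow> d < n \<Longrightarrow> d \<noteq> d0 j \<Longrightarrow> n * v j (d0 j) + d0 j < n * v j d + d"
    using good unfolding good_def by blast+
  define \<mu> where "\<mu> j = int (n * v j (d0 j) + d0 j)" for j
  define \<pi> where "\<pi> = block_shift U n (\<lambda>j. n - d0 j)"
  define D where "D a b = circ n (a mod n) (b mod n)" for a b
  define E where "E a b = code_exponent n k a b + int (v (a div n) (D a b))" for a b
  define w where "w a b = (\<sigma> ^^ (b div n + U * (b mod n))) (y (a div n) (D a b))" for a b
  \<comment> \<open>After scaling by \<open>n\<close>, the wrap-around bit equals
    \<open>D a b - a mod n + b mod n\<close>. The part depending on the row alone goes into
    \<open>r\<close>, while \<open>b mod n\<close> is the column potential.\<close>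
  define r where "r a = \<mu> (a div n) - int n * k - int (a mod n)" for a
  have D: "D a b < n" if "a < U * n" "b < U * n" for a b
    unfolding D_def using less_mult_div_mod that by (intro circ_less) auto
  have Dj: "int (D a b) = int (a mod n) - int (b mod n) + (if b mod n \<le> a mod n then 0 else int n)"
    if "a < U * n" "b < U * n" for a b
    using less_mult_div_mod(2)[OF that(1)] less_mult_div_mod(2)[OF that(2)]
    by (auto simp: D_def circ_def)
  \<comment> \<open>The excess over the potentials: the first summand is nonnegative and vanishes
    only for \<open>D a b = d0 (a div n)\<close>, the second is positive off the diagonal
    blocks.\<close>
  have nE: "int n * E a b - (r a + int (b mod n)) =
      (int (n * v (a div n) (D a b) + D a b) - \<mu> (a div n)) + (if b div n = a div n then 0 else int n * k)"
    if "a < U * n" "b < U * n" for a b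
    using Dj[OF that] by (simp add: E_def r_def code_exponent_def algebra_simps)
  have D_eq: "D a b = d0 (a div n) \<longleftrightarrow> b mod n = (a mod n + (n - d0 (a div n))) mod n"
    if "a < U * n" "b < U * n" for a b
    unfolding D_def using less_mult_div_mod that d0 by (intro circ_eq_iff) auto
  have lt: "\<pi> a < U * n" if "a < U * n" for a
    using permutes_in_image[OF block_shift_permutes, of U n _ a] that by (simp add: \<pi>_def)
  have \<pi>: "\<pi> a div n = a div n" "D a (\<pi> a) = d0 (a div n)" if "a < U * n" for a
    using block_shift_div[OF that, of "\<lambda>j. n - d0 j"] D_eq[OF that lt[OF that]]
    by (simp_all add: \<pi>_def)
  show ?thesis
  proof (rule det_nonzero_unique_minimum[OF Z, where \<pi> = \<pi> and N = "int n" and E = E and y = w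
        and r = r and s = "\<lambda>b. int (b mod n)"])
    show "\<pi> permutes {0..<U * n}" unfolding \<pi>_def by (rule block_shift_permutes)
    show "0 < int n" using n_pos by simp
    fix a assume a: "a < U * n"
    have ja: "a div n < U" using less_mult_div_mod(1)[OF a] .
    show "int n * E a (\<pi> a) = r a + int (\<pi> a mod n)"
      using nE[OF a lt[OF a]] \<pi>[OF a] by (simp add: \<mu>_def)
    show "\<not> p_dvd (w a (\<pi> a))"
      unfolding w_def \<pi>[OF a] using y[OF ja d0[OF ja]] nd[OF ja] by (intro not_p_dvd_funpow)
    fix b assume b: "b < U * n"
    have yL: "y (a div n) (D a b) \<in> OL" using y[OF ja D[OF a b]] .
    show "w a b \<in> OL" unfolding w_def by (rule OL_funpow[OF yL])
    have "(\<sigma> ^^ e) (p ^ m * z) = p ^ m * (\<sigma> ^^ e) z" if "z \<in> L" for e m z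
      using subfield_endo.hom_mult[OF funpow_endo, OF L_power[OF p_L] that]
        subfield_endo.hom_power[OF funpow_endo, OF p_L] funpow_K[OF p_K] by simp
    then show "Z $$ (a, b) = p powi E a b * w a b"
      unfolding Z_index[OF a b] D_def[symmetric] vy[OF ja D[OF a b]]
      using L_if_OL[OF yL] p_nz by (simp add: E_def w_def power_int_add)
    assume ne: "b \<noteq> \<pi> a"
    have ge: "\<mu> (a div n) \<le> int (n * v (a div n) (D a b) + D a b)"
      using min[OF ja D[OF a b]] unfolding \<mu>_def of_nat_le_iff by (cases "D a b = d0 (a div n)") auto
    show "r a + int (b mod n) < int n * E a b"
    proof (cases "b div n = a div n")
      case True
      have "D a b \<noteq> d0 (a div n)"
      proof
        assume "D a b = d0 (a div n)"
        then have "b mod n = \<pi> a mod n"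
          using D_eq[OF a b] block_shift_div(2)[OF a] by (simp add: \<pi>_def)
        with True \<pi>(1)[OF a] have "b = \<pi> a" by (metis div_mult_mod_eq)
        with ne show False ..
      qed
      then have "\<mu> (a div n) < int (n * v (a div n) (D a b) + D a b)"
        unfolding \<mu>_def of_nat_less_iff by (rule min[OF ja D[OF a b]])
      then show ?thesis using nE[OF a b] True by simp
    next
      case False
      moreover have "0 < int n * k" using k n_pos by simp
      ultimately show ?thesis using nE[OF a b] ge by simp
    qed
  qed
qed

lemma Z_L:
  assumes "a < U * n" "b < U * n"
  shows "Z $$ (a, b) \<in> L"
  unfolding Z_index[OF assms]
  using coefficient_OL[OF assms] by (intro L_closed(5) L_powi p_L funpow_closed) simp

text \<open>Within each block, conjugation by the generator with \<open>n\<close>-th power \<open>p\<close> of the cyclic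
  algebra induces \<open>\<tau> = \<sigma>\<^sup>U\<close>; on entries this is a cyclic shift of the indices.\<close>

lemma det_fixed: "(\<sigma> ^^ U) (det Z) = det Z"
proof -
  define \<rho> where "\<rho> = block_shift U n (\<lambda>_. 1)"
  \<comment> \<open>Only the last row and the last column of a block need a factor, since only there
    the wrap-around bit can change.\<close>
  define g where "g a = p powi (if a mod n = n - 1 then 1 else 0)" for a
  define c where "c a = p powi (if a mod n = n - 1 then - 1 else 0)" for a
  have "(\<sigma> ^^ U) (Z $$ (a, b)) = c a * Z $$ (\<rho> a, \<rho> b) * g b"
    if a: "a < U * n" and b: "b < U * n" for a b
  proof -
    define i where "i = a mod n"
    define j where "j = b mod n"
    have ij: "i < n" "j < n" using less_mult_div_mod a b by (auto simp: i_def j_def)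
    have \<rho>: "\<rho> a' div n = a' div n" "\<rho> a' mod n = (a' mod n + 1) mod n" "\<rho> a' < U * n"
      if "a' < U * n" for a'
      using block_shift_div[OF that, of "\<lambda>_. 1"] permutes_in_image[OF block_shift_permutes, of U n "\<lambda>_. 1" a'] that
      by (simp_all add: \<rho>_def)
    define z where "z = x (a div n) (Suc (circ n i j))"
    have z: "z \<in> L" using coefficient_OL[OF a b] by (simp add: z_def i_def j_def)
    have circ: "circ n ((i + 1) mod n) ((j + 1) mod n) = circ n i j"
      using ij by (rule circ_Suc_mod)
    \<comment> \<open>Leaving the last column would give the iterate \<open>U * n\<close>, which is
      the identity on \<open>L\<close>, so the index may be reduced modulo \<open>n\<close>.\<close>
    have pw: "(\<sigma> ^^ (e + U * (j + 1))) z = (\<sigma> ^^ (e + U * ((j + 1) mod n))) z" for e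
    proof (cases "j + 1 < n")
      case False
      then have "j + 1 = n" using ij by simp
      then show ?thesis using order[OF z] by (simp add: funpow_add)
    qed simp
    have ex: "code_exponent n k a b = (if i = n - 1 then - 1 else 0) + code_exponent n k (\<rho> a) (\<rho> b)
        + (if j = n - 1 then 1 else 0)"
      unfolding code_exponent_def \<rho>(1,2)[OF a] \<rho>(1,2)[OF b] i_def[symmetric] j_def[symmetric]
      using wrap_Suc_mod[OF ij] by simp
    have "(\<sigma> ^^ U) (Z $$ (a, b)) = (\<sigma> ^^ U) (p powi code_exponent n k a b * (\<sigma> ^^ (b div n + U * j)) z)"
      unfolding Z_index[OF a b] by (simp add: z_def i_def j_def)
    also have "\<dots> = p powi code_exponent n k a b * (\<sigma> ^^ U) ((\<sigma> ^^ (b div n + U * j)) z)"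
      using subfield_endo.hom_mult[OF funpow_endo[of U] L_powi[OF p_L] funpow_closed[OF z]]
        funpow_p_powi by simp
    also have "(\<sigma> ^^ U) ((\<sigma> ^^ (b div n + U * j)) z) = (\<sigma> ^^ (b div n + U * (j + 1))) z"
      by (simp add: algebra_simps flip: funpow_add[THEN fun_cong, unfolded comp_def])
    also note pw
    also have "p powi code_exponent n k a b =
        c a * p powi code_exponent n k (\<rho> a) (\<rho> b) * g b"
      unfolding ex c_def g_def i_def j_def using p_nz by (subst power_int_add, simp)+ simp
    also have "c a * p powi code_exponent n k (\<rho> a) (\<rho> b) * g b * (\<sigma> ^^ (b div n + U * ((j + 1) mod n))) z
        = c a * Z $$ (\<rho> a, \<rho> b) * g b"
      unfolding Z_index[OF \<rho>(3)[OF a] \<rho>(3)[OF b]] using \<rho>[OF a] \<rho>[OF b] circ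
      by (simp add: z_def i_def j_def mult_ac)
    finally show ?thesis .
  qed
  then have "map_mat (\<sigma> ^^ U) Z = mat (U * n) (U * n) (\<lambda>(a, b). c a * Z $$ (\<rho> a, \<rho> b) * g b)"
    using Z by (intro eq_matI) auto
  moreover have "det \<dots> = det Z"
    using p_nz by (intro det_permute_scale[OF Z]) (auto simp: \<rho>_def block_shift_permutes c_def g_def)
  ultimately show ?thesis
    using subfield_endo.det_hom(2)[OF funpow_endo Z Z_L] by simp
qed

text \<open>Every exponent of \<open>p\<close> in \<open>Z\<close> is at least \<open>- k\<close>,
  so \<open>p ^ nat k\<close> clears all denominators. This factor enters the determinant
  \<open>U * n\<close> times and each of the \<open>U\<close> conjugates once more; their product is
  bounded below because \<open>\<sigma> ^^ U\<close> fixes the determinant.\<close>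

lemma det_conjugates_bound:
  "1 \<le> norm p ^ (nat k * (U * n) * U) * (\<Prod>e<U. norm ((\<sigma> ^^ e) (det Z)))"
proof -
  let ?W = "p ^ nat k \<cdot>\<^sub>m Z"
  have W: "?W \<in> carrier_mat (U * n) (U * n)" using Z by simp
  have "?W $$ (a, b) \<in> OL" if ab: "a < U * n" "b < U * n" for a b
  proof -
    let ?y = "(\<sigma> ^^ (b div n + U * (b mod n))) (x (a div n) (Suc (circ n (a mod n) (b mod n))))"
    have "0 \<le> k + code_exponent n k a b" using k by (simp add: code_exponent_def)
    then obtain m where m: "k + code_exponent n k a b = int m" using nonneg_int_cases by blast
    have "?W $$ (a, b) = p powi (k + code_exponent n k a b) * ?y"
    proof -
      have "p ^ nat k = p powi k" using k by (simp add: power_int_def)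
      moreover have "?W $$ (a, b) = p ^ nat k * (p powi code_exponent n k a b * ?y)"
        using ab Z by (simp add: Z_index)
      ultimately show ?thesis by (simp only: power_int_add[OF disjI1[OF p_nz]] mult.assoc)
    qed
    also have "\<dots> = p ^ m * ?y" by (simp only: m power_int_of_nat)
    finally show ?thesis
      using OL_mult[OF OL_power[OF OL_p] OL_funpow[OF coefficient_OL[OF ab]]] by (simp only:)
  qed
  then have O: "det ?W \<in> OL" by (rule OL_det[OF W])
  have dW: "det ?W = p ^ (nat k * (U * n)) * det Z" using Z by (simp add: power_mult)
  have detL: "det Z \<in> L" using det_hom(1)[OF Z Z_L] .
  have conj: "(\<sigma> ^^ e) (det ?W) = p ^ (nat k * (U * n)) * (\<sigma> ^^ e) (det Z)" for e
    unfolding dW using subfield_endo.hom_mult[OF funpow_endo, OF L_power[OF p_L] detL]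
      subfield_endo.hom_power[OF funpow_endo, OF p_L] funpow_K[OF p_K] by simp
  have "1 \<le> norm (\<Prod>e<U. (\<sigma> ^^ e) (det ?W))"
    using O det_nonzero p_nz conj[of U] det_fixed U_pos dW by (intro norm_prod_conjugates) auto
  then show ?thesis
    unfolding conj by (simp add: prod.distrib norm_mult norm_power power_mult prod_norm)
qed

end

section \<open>The lower bound\<close>

text \<open>Each Leibniz term takes one entry from every row. Bounds that vary with the row keep the
  contributions of different users separate.\<close>

lemma norm_det_le:
  fixes A :: "complex mat"
  assumes A: "A \<in> carrier_mat m m"
    and R: "\<And>i j. i < m \<Longrightarrow> j < m \<Longrightarrow> norm (A $$ (i, j)) \<le> R i"
  shows "norm (det A) \<le> fact m * (\<Prod>i<m. R i)"
proof -
  have "norm (det A) \<le> (\<Sum>q | q permutes {0..<m}. norm (signof q * (\<Prod>i=0..<m. A $$ (i, q i))))"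
    unfolding det_def'[OF A] by (rule norm_sum)
  also have "\<dots> \<le> (\<Sum>q | q permutes {0..<m}. \<Prod>i<m. R i)"
  proof (rule sum_mono)
    fix q assume "q \<in> {q. q permutes {0..<m}}"
    then have q: "q i < m" if "i < m" for i using that permutes_in_image[of q "{0..<m}" i] by simp
    have "norm (signof q * (\<Prod>i=0..<m. A $$ (i, q i))) = (\<Prod>i<m. norm (A $$ (i, q i)))"
      by (simp add: norm_mult sign_def prod_norm atLeast0LessThan)
    also have "\<dots> \<le> (\<Prod>i<m. R i)" using R q by (intro prod_mono) auto
    finally show "norm (signof q * (\<Prod>i=0..<m. A $$ (i, q i))) \<le> (\<Prod>i<m. R i)" .
  qed
  also have "\<dots> = fact m * (\<Prod>i<m. R i)"
    using card_permutations[of "{0..<m}" m] by simp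
  finally show ?thesis .
qed

lemma prod_div_blocks: "0 < n \<Longrightarrow> (\<Prod>a<U * n. f (a div n)) = (\<Prod>j<U. f j) ^ n"
  for f :: "nat \<Rightarrow> 'a :: comm_semiring_1"
proof -
  assume n: "0 < n"
  have "(\<Prod>a<U * n. f (a div n)) = (\<Prod>j<U. \<Prod>a=j * n..<j * n + n. f (a div n))"
    by (rule prod.nat_group[symmetric])
  also have "\<dots> = (\<Prod>j<U. \<Prod>a=j * n..<j * n + n. f j)"
  proof (intro prod.cong refl)
    fix j a assume "a \<in> {j * n..<j * n + n}"
    then have "a div n = j" using n by (intro div_nat_eqI) (auto simp: mult.commute)
    then show "f (a div n) = f j" by simp
  qed
  also have "\<dots> = (\<Prod>j<U. f j) ^ n" by (simp flip: prod_power_distrib)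
  finally show ?thesis .
qed

section \<open>Finiteness and nonemptiness of the sets behind the decay function\<close>

lemma int_comb_cong:
  "(\<And>i. i \<in> {1..r} \<Longrightarrow> b i = b' i) \<Longrightarrow> int_comb nr nc r B b = int_comb nr nc r B b'"
  unfolding int_comb_def by (intro cong_mat) (auto intro!: sum.cong)

text \<open>Coefficient functions are arbitrary outside \<open>{1..r}\<close>; restricting them
  there leaves a finite product of intervals with the same matrices.\<close>

lemma finite_lattice_box: "finite (lattice_box nr nc r B N)"
proof (rule finite_subset)
  show "lattice_box nr nc r B N \<subseteq> int_comb nr nc r B ` (PiE {1..r} (\<lambda>_. {- int N..int N}))"
  proof
    fix V assume "V \<in> lattice_box nr nc r B N"
    then obtain b where b: "V = int_comb nr nc r B b" "\<forall>i\<in>{1..r}. - int N \<le> b i \<and> b i \<le> int N"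
      unfolding lattice_box_def by blast
    have "V = int_comb nr nc r B (restrict b {1..r})"
      unfolding b(1) by (rule int_comb_cong) simp
    moreover have "restrict b {1..r} \<in> PiE {1..r} (\<lambda>_. {- int N..int N})" using b(2) by auto
    ultimately show "V \<in> int_comb nr nc r B ` (PiE {1..r} (\<lambda>_. {- int N..int N}))" by blast
  qed
  show "finite (int_comb nr nc r B ` (PiE {1..r} (\<lambda>_. {- int N..int N})))"
    by (intro finite_imageI finite_PiE) auto
qed

lemma stack_cong:
  assumes "\<And>j. j \<in> {1..U} \<Longrightarrow> Y j = Y' j"
  shows "stack U n Y = stack U n Y'"
  unfolding stack_def
proof (intro cong_mat refl)
  fix a b assume "a < U * n"
  then have "a div n + 1 \<in> {1..U}" using less_mult_div_mod(1)[of a U n] by simp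
  from assms[OF this] show "(case (a, b) of (a, b) \<Rightarrow> Y (a div n + 1) $$ (a mod n, b)) =
      (case (a, b) of (a, b) \<Rightarrow> Y' (a div n + 1) $$ (a mod n, b))" by simp
qed

lemma finite_stack_values:
  assumes "\<And>j. j \<in> {1..U} \<Longrightarrow> finite (S j)"
  shows "finite {norm (det (stack U n Y)) | Y. \<forall>j\<in>{1..U}. Y j \<in> S j}"
proof (rule finite_subset)
  show "{norm (det (stack U n Y)) | Y. \<forall>j\<in>{1..U}. Y j \<in> S j} \<subseteq>
      (\<lambda>Y. norm (det (stack U n Y))) ` PiE {1..U} S"
  proof
    fix t assume "t \<in> {norm (det (stack U n Y)) | Y. \<forall>j\<in>{1..U}. Y j \<in> S j}"
    then obtain Y where Y: "t = norm (det (stack U n Y))" "\<forall>j\<in>{1..U}. Y j \<in> S j" by blast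
    have "t = norm (det (stack U n (restrict Y {1..U})))"
      unfolding Y(1) by (subst stack_cong[of U Y "restrict Y {1..U}"]) auto
    moreover have "restrict Y {1..U} \<in> PiE {1..U} S" using Y(2) by auto
    ultimately show "t \<in> (\<lambda>Y. norm (det (stack U n Y))) ` PiE {1..U} S" by blast
  qed
  show "finite ((\<lambda>Y. norm (det (stack U n Y))) ` PiE {1..U} S)"
    using assms by (intro finite_imageI finite_PiE) auto
qed

text \<open>The first basis element lies in every box and is nonzero by linear independence.\<close>

lemma lattice_box_nonzero:
  assumes B: "is_Z_basis nr nc r B \<Lambda>" and "0 < r" "0 < N"
  shows "lattice_box nr nc r B N - {0\<^sub>m nr nc} \<noteq> {}"
proof -
  define b :: "nat \<Rightarrow> int" where "b i = (if i = 1 then 1 else 0)" for i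
  have "int_comb nr nc r B b \<noteq> 0\<^sub>m nr nc"
  proof
    assume "int_comb nr nc r B b = 0\<^sub>m nr nc"
    then have "\<forall>i\<in>{1..r}. b i = 0" using B unfolding is_Z_basis_def by blast
    then have "b 1 = 0" using \<open>0 < r\<close> by (metis One_nat_def Suc_leI atLeastAtMost_iff order_refl)
    then show False by (simp add: b_def)
  qed
  moreover have "int_comb nr nc r B b \<in> lattice_box nr nc r B N"
    unfolding lattice_box_def using \<open>0 < N\<close> by (auto simp: b_def)
  ultimately show ?thesis by blast
qed

section \<open>Lower bound for the determinants of stacked lattice points\<close>

context code_field
begin

lemma user_codeE:
  assumes "V \<in> user_code U n L p \<sigma> k j"
  obtains x where "V = user_matrix U n p \<sigma> k j (code_matrix n p (\<sigma> ^^ U) x)"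
    "\<And>h. h \<in> {1..n} \<Longrightarrow> x h \<in> OL" "\<exists>h\<in>{1..n}. x h \<noteq> 0"
proof -
  from assms obtain x where "V = user_matrix U n p \<sigma> k j (code_matrix n p (\<sigma> ^^ U) x)"
    and "\<forall>h\<in>{1..n}. x h \<in> carrier (int_ring_of L)" "\<exists>h\<in>{1..n}. x h \<noteq> 0"
    unfolding user_code_def by blast
  then show ?thesis using that[of x] by (simp add: int_ring_of_def)
qed

text \<open>Basis matrices must have entries in \<open>L\<close>, so that conjugation passes through
  integer combinations of them.\<close>

lemma user_lattice_index_L:
  assumes "V \<in> user_lattice U n L p \<sigma> k (Suc j)" "s < n" "b < U * n"
  shows "V $$ (s, b) \<in> L"
proof -
  from assms(1) consider "V \<in> user_code U n L p \<sigma> k (Suc j)" | "V = 0\<^sub>m n (U * n)"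
    unfolding user_lattice_def by blast
  then show ?thesis
  proof cases
    case 1
    then show ?thesis
    proof (rule user_codeE)
      fix x
      assume V: "V = user_matrix U n p \<sigma> k (Suc j) (code_matrix n p (\<sigma> ^^ U) x)"
        and x: "\<And>h. h \<in> {1..n} \<Longrightarrow> x h \<in> OL"
      note i = circ_less[OF assms(2) less_mult_div_mod(2)[OF assms(3)]]
      have "x (Suc (circ n s (b mod n))) \<in> L"
        using x[of "Suc (circ n s (b mod n))"] i by simp
      then show ?thesis
        using user_matrix_index[OF x assms(2,3)] L_closed(5) L_powi[OF p_L] funpow_closed
        by (simp only: V)
    qed
  next
    case 2
    then show ?thesis using assms(2,3) L_closed(1) by simp
  qed
qed

lemma stack_code_word:
  assumes k: "1 \<le> k" and Y: "\<And>j. j \<in> {1..U} \<Longrightarrow> Y j \<in> user_code U n L p \<sigma> k j"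
  obtains x where "code_word L \<sigma> K p U n k x (stack U n Y)"
proof -
  define P where "P j x \<longleftrightarrow> Y (Suc j) = user_matrix U n p \<sigma> k (Suc j) (code_matrix n p (\<sigma> ^^ U) x) \<and>
      (\<forall>h\<in>{1..n}. x h \<in> OL) \<and> (\<exists>h\<in>{1..n}. x h \<noteq> 0)" for j x
  have "\<exists>x. P j x" if j: "j < U" for j
  proof -
    have "Y (Suc j) \<in> user_code U n L p \<sigma> k (Suc j)" using Y j by simp
    then show ?thesis by (rule user_codeE) (unfold P_def, blast)
  qed
  then obtain x where P: "\<And>j. j < U \<Longrightarrow> P j (x j)" by metis
  show ?thesis
  proof (rule that, unfold_locales)
    show "1 \<le> k" by (rule k)
    show "x j h \<in> OL" if "j < U" "h \<in> {1..n}" for j h using P[OF that(1)] that(2) unfolding P_def by blast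
    show "\<exists>h\<in>{1..n}. x j h \<noteq> 0" if "j < U" for j using P[OF that] unfolding P_def by blast
    show "stack U n Y \<in> carrier_mat (U * n) (U * n)" by (simp add: stack_def)
    fix a b assume a: "a < U * n" and b: "b < U * n"
    note lt = less_mult_div_mod[OF a]
    have Yj: "Y (Suc (a div n)) = user_matrix U n p \<sigma> k (Suc (a div n)) (code_matrix n p (\<sigma> ^^ U) (x (a div n)))"
      and xj: "\<And>h. h \<in> {1..n} \<Longrightarrow> x (a div n) h \<in> OL" using P[OF lt(1)] unfolding P_def by blast+
    show "stack U n Y $$ (a, b) = p powi code_exponent n k a b *
        (\<sigma> ^^ (b div n + U * (b mod n))) (x (a div n) (Suc (circ n (a mod n) (b mod n))))"
    proof -
      have "stack U n Y $$ (a, b) = Y (Suc (a div n)) $$ (a mod n, b)" using a b by (simp add: stack_def)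
      then show ?thesis unfolding Yj code_exponent_def by (simp only: user_matrix_index[OF xj lt(2) b])
    qed
  qed
qed

text \<open>Since \<open>det Z\<close> is fixed by \<open>\<sigma>\<^sup>U\<close>, only \<open>U\<close> conjugates enter its norm to \<open>K\<close>; hence the
  exponent \<open>(U - 1) n\<close>.\<close>

lemma norm_det_stack_ge:
  fixes B :: "nat \<Rightarrow> nat \<Rightarrow> complex mat"
  assumes k: "1 \<le> k"
    and B: "\<forall>j\<in>{1..U}. is_Z_basis n (U * n) r (B j) (user_lattice U n L p \<sigma> k j)"
  shows "\<exists>c>0. \<forall>N Y.
    (\<forall>j\<in>{1..U}. 0 < N j \<and> Y j \<in> lattice_box n (U * n) r (B j) (N j) - {0\<^sub>m n (U * n)}) \<longrightarrow>
    c / (\<Prod>j=1..U. real (N j)) ^ ((U - 1) * n) \<le> norm (det (stack U n Y))"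
proof -
  define I where "I = {1..U} \<times> {..<U} \<times> {..<n} \<times> {..<U * n}"
  \<comment> \<open>\<open>T\<close> bounds one conjugated entry per unit of box size. Summing over
    all users, conjugations and positions in \<open>S\<close> gives a constant that depends on the
    basis but not on the box sizes.\<close>
  define T where "T = (\<lambda>(j, e, s, b). \<Sum>i=1..r. norm ((\<sigma> ^^ e) (B j i $$ (s, b))))"
  define S where "S = sum T I"
  \<comment> \<open>The factorial counts the Leibniz terms; the added 1 secures positivity, since
    \<open>S\<close> is only known to be nonnegative.\<close>
  define C where "C = fact (U * n) * S ^ (U * n) + 1"
  define P where "P = norm p ^ (nat k * (U * n) * U)"
  have T: "0 \<le> T t" for t by (auto simp: T_def split: prod.split intro!: sum_nonneg)
  have "0 \<le> S" unfolding S_def using T by (intro sum_nonneg)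
  then have C: "0 < C" by (simp add: C_def add_nonneg_pos)
  have P: "0 < P" using p_nz by (simp add: P_def)
  show ?thesis
  proof (intro exI[of _ "1 / (P * C ^ (U - 1))"] conjI allI impI)
    show "0 < 1 / (P * C ^ (U - 1))" using P C by simp
    fix N :: "nat \<Rightarrow> nat" and Y
    assume NY: "\<forall>j\<in>{1..U}. 0 < N j \<and> Y j \<in> lattice_box n (U * n) r (B j) (N j) - {0\<^sub>m n (U * n)}"
    have N: "\<And>j. j \<in> {1..U} \<Longrightarrow> 0 < N j"
      and Y: "\<And>j. j \<in> {1..U} \<Longrightarrow> Y j \<in> lattice_box n (U * n) r (B j) (N j) - {0\<^sub>m n (U * n)}"
      using NY by blast+
    define M where "M = (\<Prod>j=1..U. real (N j))"
    have M: "0 < M" unfolding M_def using N by (intro prod_pos) auto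
    have Ycode: "Y j \<in> user_code U n L p \<sigma> k j" if j: "j \<in> {1..U}" for j
    proof -
      have "Y j \<in> user_lattice U n L p \<sigma> k j"
        using Y[OF j] bspec[OF B j] unfolding is_Z_basis_def lattice_box_def by blast
      then show ?thesis using Y[OF j] by (simp add: user_lattice_def)
    qed
    obtain x where "code_word L \<sigma> K p U n k x (stack U n Y)"
      by (rule stack_code_word[OF k Ycode])
    then interpret W: code_word L \<sigma> K p U n k x "stack U n Y" .
    let ?Z = "stack U n Y"
    have upper: "norm ((\<sigma> ^^ e) (det ?Z)) \<le> C * M ^ n" if e: "e < U" for e
    proof -
      interpret f: subfield_endo L "\<sigma> ^^ e" by (rule funpow_endo)
      have "norm (map_mat (\<sigma> ^^ e) ?Z $$ (a, b)) \<le> S * real (N (Suc (a div n)))"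
        if a: "a < U * n" and b: "b < U * n" for a b
      proof -
        let ?j = "Suc (a div n)" and ?s = "a mod n"
        have j: "?j \<in> {1..U}" and s: "?s < n" using less_mult_div_mod[OF a] by auto
        obtain \<beta> where \<beta>: "Y ?j = int_comb n (U * n) r (B ?j) \<beta>"
          "\<And>i. i \<in> {1..r} \<Longrightarrow> - int (N ?j) \<le> \<beta> i \<and> \<beta> i \<le> int (N ?j)"
          using Y[OF j] unfolding lattice_box_def by blast
        have BL: "B ?j i $$ (?s, b) \<in> L" if "i \<in> {1..r}" for i
          using bspec[OF B j] that user_lattice_index_L[OF _ s b] unfolding is_Z_basis_def by blast
        have "map_mat (\<sigma> ^^ e) ?Z $$ (a, b) = (\<sigma> ^^ e) (Y ?j $$ (?s, b))"
          using a b by (simp add: stack_def)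
        also have "Y ?j $$ (?s, b) = (\<Sum>i=1..r. of_int (\<beta> i) * B ?j i $$ (?s, b))"
          using s b by (simp add: \<beta>(1) int_comb_def)
        also have "(\<sigma> ^^ e) \<dots> = (\<Sum>i=1..r. (\<sigma> ^^ e) (of_int (\<beta> i) * B ?j i $$ (?s, b)))"
          using BL L_of_int by (intro f.hom_sum L_closed(5))
        also have "\<dots> = (\<Sum>i=1..r. of_int (\<beta> i) * (\<sigma> ^^ e) (B ?j i $$ (?s, b)))"
          using BL L_of_int f.hom_of_int by (intro sum.cong) (auto simp: f.hom_mult)
        also have "norm \<dots> \<le> (\<Sum>i=1..r. real (N ?j) * norm ((\<sigma> ^^ e) (B ?j i $$ (?s, b))))"
        proof (rule sum_norm_le)
          fix i assume "i \<in> {1..r}"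
          from \<beta>(2)[OF this] have "\<bar>\<beta> i\<bar> \<le> int (N ?j)" by linarith
          then have "\<bar>real_of_int (\<beta> i)\<bar> \<le> real (N ?j)" by linarith
          then show "norm (of_int (\<beta> i) * (\<sigma> ^^ e) (B ?j i $$ (?s, b))) \<le>
              real (N ?j) * norm ((\<sigma> ^^ e) (B ?j i $$ (?s, b)))"
            unfolding norm_mult norm_of_int by (intro mult_right_mono) auto
        qed
        also have "\<dots> = real (N ?j) * T (?j, e, ?s, b)" by (simp add: T_def sum_distrib_left)
        also have "\<dots> \<le> real (N ?j) * S"
          unfolding S_def using j e s b T by (intro mult_left_mono member_le_sum) (auto simp: I_def)
        finally show ?thesis by (simp only: mult.commute)
      qed
      then have "norm (det (map_mat (\<sigma> ^^ e) ?Z)) \<le>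
          fact (U * n) * (\<Prod>a<U * n. S * real (N (Suc (a div n))))"
        using W.Z by (intro norm_det_le) auto
      also have "(\<Prod>a<U * n. S * real (N (Suc (a div n)))) = S ^ (U * n) * M ^ n"
        using prod_div_blocks[OF n_pos, of "\<lambda>j. real (N (Suc j))" U]
          prod.atLeast1_atMost_eq[of "\<lambda>j. real (N j)" U]
        by (simp add: prod.distrib M_def)
      also have "fact (U * n) * (S ^ (U * n) * M ^ n) \<le> C * M ^ n"
        using M by (simp add: C_def distrib_right)
      finally show ?thesis using f.det_hom(2)[OF W.Z W.Z_L] by simp
    qed
    obtain u where u: "U = Suc u" using U_pos by (cases U) auto
    have "1 \<le> P * (\<Prod>e<U. norm ((\<sigma> ^^ e) (det ?Z)))"
      using W.det_conjugates_bound by (simp add: P_def)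
    \<comment> \<open>The conjugate with \<open>e = 0\<close> is the determinant itself; the other
      \<open>U - 1\<close> are estimated from above.\<close>
    also have "(\<Prod>e<U. norm ((\<sigma> ^^ e) (det ?Z))) =
        norm (det ?Z) * (\<Prod>e<u. norm ((\<sigma> ^^ Suc e) (det ?Z)))"
      unfolding u prod.lessThan_Suc_shift by simp
    also have "P * \<dots> \<le> P * (norm (det ?Z) * (\<Prod>e<u. C * M ^ n))"
      using P upper u by (intro mult_left_mono prod_mono) (auto simp del: funpow.simps)
    also have "\<dots> = norm (det ?Z) * (P * C ^ (U - 1) * M ^ ((U - 1) * n))"
      by (simp add: u power_mult_distrib mult_ac flip: power_mult)
    finally have "1 / (P * C ^ (U - 1) * M ^ ((U - 1) * n)) \<le> norm (det ?Z)"
      using P C M by (simp add: pos_divide_le_eq)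
    then show "1 / (P * C ^ (U - 1)) / (\<Prod>j=1..U. real (N j)) ^ ((U - 1) * n) \<le> norm (det ?Z)"
      unfolding M_def[symmetric] by simp
  qed
qed

end

theorem theorem5p4:
  fixes U n :: nat and K L :: "complex set" and p :: complex and \<sigma> :: "complex \<Rightarrow> complex"
    and k :: int and B :: "nat \<Rightarrow> nat \<Rightarrow> complex mat"
  assumes "U > 0" and "n > 0"
    and "suitable U n K L p \<sigma>"
    and "real_of_int k > real U * (real n - 1) / 2"
    and "\<forall>j\<in>{1..U}. is_Z_basis n (U * n) (2 * U * n\<^sup>2) (B j) (user_lattice U n L p \<sigma> k j)"
  shows "\<exists>c::real. c > 0 \<and>
    (\<forall>N :: nat \<Rightarrow> nat. (\<forall>j\<in>{1..U}. N j > 0) \<longrightarrow>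
       decay U n B N \<ge> c / (\<Prod>j=1..U. real (N j)) ^ ((U - 1) * n)) \<and>
    (\<forall>N :: nat. N > 0 \<longrightarrow> decay U n B (\<lambda>_. N) \<ge> c / real N ^ (U * (U - 1) * n))"
proof -
  interpret code_field L \<sigma> K p U n by (rule code_field_suitable[OF assms(3,1,2)])
  let ?r = "2 * U * n\<^sup>2"
  have "0 \<le> real U * (real n - 1) / 2" using assms(2) by simp
  \<comment> \<open>An integer above a nonnegative bound is at least 1.\<close>
  then have k: "1 \<le> k" using assms(4) by linarith
  obtain c :: real where c: "0 < c" and bound: "\<forall>N Y.
      (\<forall>j\<in>{1..U}. 0 < N j \<and> Y j \<in> lattice_box n (U * n) ?r (B j) (N j) - {0\<^sub>m n (U * n)}) \<longrightarrow>
      c / (\<Prod>j=1..U. real (N j)) ^ ((U - 1) * n) \<le> norm (det (stack U n Y))"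
    using norm_det_stack_ge[OF k assms(5)] by (elim exE conjE) (rule that)
  have main: "c / (\<Prod>j=1..U. real (N j)) ^ ((U - 1) * n) \<le> decay U n B N"
    if N: "\<forall>j\<in>{1..U}. N j > 0" for N
  proof -
    let ?S = "\<lambda>j. lattice_box n (U * n) ?r (B j) (N j) - {0\<^sub>m n (U * n)}"
    let ?D = "{norm (det (stack U n Y)) | Y. \<forall>j\<in>{1..U}. Y j \<in> ?S j}"
    have r: "0 < ?r" using assms(1,2) by simp
    have "finite ?D" by (intro finite_stack_values finite_Diff finite_lattice_box)
    \<comment> \<open>\<open>Min\<close> attains its value only on a finite nonempty set, so each
      user needs some nonzero lattice point in its box.\<close>
    moreover have "?D \<noteq> {}"
    proof -
      define Y0 where "Y0 j = (SOME V. V \<in> ?S j)" for j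
      have "Y0 j \<in> ?S j" if j: "j \<in> {1..U}" for j
      proof -
        have "0 < N j" using N j by blast
        from lattice_box_nonzero[OF bspec[OF assms(5) j] r this] show ?thesis
          unfolding Y0_def by (rule some_in_eq[THEN iffD2])
      qed
      then have "norm (det (stack U n Y0)) \<in> ?D" by blast
      then show ?thesis by (rule ex_in_conv[THEN iffD1, OF exI])
    qed
    moreover have "c / (\<Prod>j=1..U. real (N j)) ^ ((U - 1) * n) \<le> t" if t: "t \<in> ?D" for t
    proof -
      from t obtain Y where Y: "t = norm (det (stack U n Y))" "\<forall>j\<in>{1..U}. Y j \<in> ?S j" by blast
      show ?thesis unfolding Y(1)
        by (rule bound[rule_format]) (use N Y(2) in blast)
    qed
    ultimately show ?thesis unfolding decay_def by (intro Min.boundedI)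
  qed
  \<comment> \<open>For equal box sizes the product over the users is \<open>N ^ U\<close>, which
    supplies the extra factor \<open>U\<close> in the exponent.\<close>
  have "c / real N ^ (U * (U - 1) * n) \<le> decay U n B (\<lambda>_. N)" if "N > 0" for N
    using main[of "\<lambda>_. N"] that by (simp add: mult.assoc flip: power_mult)
  with c main show ?thesis by blast
qed

end
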